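(* Let $n\ge 2$, let $F:\mathbf{R}^n\to\mathbf{R}$ be an integrand, and let $\gamma\in \mathrm{AC}([0,1];\mathbf{R}^n)$ be regular. Set $\hat v:=\gamma(1)-\gamma(0)$ and let $\overline{x}\in K_F$ be such that $\|\hat v\|_F=\langle \hat v,\overline{x}\rangle$. Then the following are equivalent: (1) $\gamma$ is an $F$-geodesic; (2) $\mathfrak{L}_F(\gamma)=\|\hat v\|_F$; (3) for almost every $t\in(0,1)$, $\dot\gamma(t)\in \mathrm{Cont}(F)$ and $\overline{x}+(\dot\gamma(t))^\perp$ is a supporting hyperplane for $K_F$ at $\overline{x}$.
   Context: $\mathbb{S}^{n-1}$ is the unit sphere in $\mathbf{R}^n$. A function $F:\mathbf{R}^n\to\mathbf{R}$ is 1-homogeneous if $F(\lambda x)=\lambda F(x)$ for all $\lambda\ge0$, $x\in\mathbf{R}^n$; it is positive if $F>0$ on $\mathbb{S}^{n-1}$. An integrand is a lower semicontinuous, 1-homogeneous, positive function. $\mathrm{AC}([0,1];\mathbf{R}^n)$ is the set of absolutely continuous $\gamma:[0,1]\to\mathbf{R}^n$; $\gamma$ is regular if $|\dot\gamma(t)|>0$ for a.e. $t$. The $F$-length is $\mathfrak{L}_F(\gamma)=\int_0^1F(\dot\gamma(t))\,dt$. $\gamma$ is an $F$-geodesic if it minimizes $\mathfrak{L}_F$ among all $\rho\in\mathrm{AC}([0,1];\mathbf{R}^n)$ with $\rho(0)=\gamma(0)$, $\rho(1)=\gamma(1)$. The $F$-crystal is $K_F:=\bigcap_{v\in\mathbb{S}^{n-1}}\{x:\langle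 x,v\rangle\le F(v)\}$ (a compact convex set with $0$ in its interior). For $\Omega\subseteq\mathbf{R}^n$, its polar body is $\mathfrak{P}\Omega:=\{z:\langle z,x\rangle\le1\ \forall x\in\Omega\}$. For $z\in\mathbf{R}^n$, $\|z\|_F:=\min\{\lambda\ge0: z\in\lambda\,\mathfrak{P}K_F\}$; for every $z$ there is $\overline{x}\in K_F$ with $\langle z,\overline{x}\rangle=\|z\|_F$. Define operators on integrands: $\mathcal{W}(F)(v):=\inf_{w\in\mathbb{S}^{n-1},\langle v,w\rangle>0} F(w)/\langle v,w\rangle$ and $\mathcal{A}(G)(v):=\sup_{w\in\mathbb{S}^{n-1}} G(w)\langle v,w\rangle$ for $v\in\mathbb{S}^{n-1}$, extended to $\mathbf{R}^n$ by 1-homogeneity, and the convex envelope $\mathcal{D}(F):=\mathcal{A}(\mathcal{W}(F))$. The contact set is $\mathrm{Cont}(F):=\{x\in\mathbf{R}^n: F(x)=\mathcal{D}(F)(x)\}$. For a compact $K$ and $v\in\mathbb{S}^{n-1}$, the supporting hyperplane of $K$ associated with $v$ is $\{z:\langle z,v\rangle=\max_{y\in K}\langle y,v\rangle\}$; "$\overline{x}+u^\perp$ is a supporting hyperplane for $K_F$" (with $u\neq0$) means $\overline{x}+u^\perp$ equals the supporting hyperplane of $K_F$ associated with $u/|u|$. *)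

theory Defs
  imports "HOL-Analysis.Analysis"
begin

text \<open>Lower semicontinuity: all sublevel sets are closed.\<close>
definition lsc :: "('a::topological_space \<Rightarrow> real) \<Rightarrow> bool" where
  "lsc F \<longleftrightarrow> (\<forall>c. closed {x. F x \<le> c})"

definition one_homogeneous :: "('a::real_vector \<Rightarrow> real) \<Rightarrow> bool" where
  "one_homogeneous F \<longleftrightarrow> (\<forall>r::real. \<forall>x. r \<ge> 0 \<longrightarrow> F (r *\<^sub>R x) = r * F x)"

definition positive_on_sphere :: "('a::real_normed_vector \<Rightarrow> real) \<Rightarrow> bool" where
  "positive_on_sphere F \<longleftrightarrow> (\<forall>v. norm v = 1 \<longrightarrow> F v > 0)"

definition integrand :: "('a::real_normed_vector \<Rightarrow> real) \<Rightarrow> bool" where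
  "integrand F \<longleftrightarrow> lsc F \<and> one_homogeneous F \<and> positive_on_sphere F"

text \<open>Absolute continuity on [0,1] (epsilon-delta definition with finitely many
  pairwise non-overlapping subintervals).\<close>
definition abs_cont01 :: "(real \<Rightarrow> 'a::real_normed_vector) \<Rightarrow> bool" where
  "abs_cont01 \<gamma> \<longleftrightarrow>
     (\<forall>\<epsilon>>0. \<exists>\<delta>>0. \<forall>D::(real \<times> real) set.
        finite D \<longrightarrow>
        (\<forall>(a,b)\<in>D. 0 \<le> a \<and> a < b \<and> b \<le> 1) \<longrightarrow>
        (\<forall>(a,b)\<in>D. \<forall>(c,d)\<in>D. (a,b) \<noteq> (c,d) \<longrightarrow> {a<..<b} \<inter> {c<..<d} = {}) \<longrightarrow>
        (\<Sum>(a,b)\<in>D. b - a) < \<delta> \<longrightarrow>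
        (\<Sum>(a,b)\<in>D. norm (\<gamma> b - \<gamma> a)) < \<epsilon>)"

definition regular_curve :: "(real \<Rightarrow> 'a::real_normed_vector) \<Rightarrow> bool" where
  "regular_curve \<gamma> \<longleftrightarrow>
     (AE t in lebesgue. t \<in> {0..1} \<longrightarrow> norm (vector_derivative \<gamma> (at t)) > 0)"

text \<open>F-length (may be infinite, hence extended nonnegative reals).\<close>
definition F_length :: "('a::euclidean_space \<Rightarrow> real) \<Rightarrow> (real \<Rightarrow> 'a) \<Rightarrow> ennreal" where
  "F_length F \<gamma> = (\<integral>\<^sup>+ t \<in> {0..1}. ennreal (F (vector_derivative \<gamma> (at t))) \<partial>lebesgue)"

definition F_geodesic :: "('a::euclidean_space \<Rightarrow> real) \<Rightarrow> (real \<Rightarrow> 'a) \<Rightarrow> bool" where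
  "F_geodesic F \<gamma> \<longleftrightarrow> abs_cont01 \<gamma> \<and>
     (\<forall>\<rho>. abs_cont01 \<rho> \<and> \<rho> 0 = \<gamma> 0 \<and> \<rho> 1 = \<gamma> 1 \<longrightarrow> F_length F \<gamma> \<le> F_length F \<rho>)"

definition crystal :: "('a::euclidean_space \<Rightarrow> real) \<Rightarrow> 'a set" where
  "crystal F = (\<Inter>v\<in>{v. norm v = 1}. {x. x \<bullet> v \<le> F v})"

definition polar :: "'a::euclidean_space set \<Rightarrow> 'a set" where
  "polar \<Omega> = {z. \<forall>x\<in>\<Omega>. z \<bullet> x \<le> 1}"

definition F_norm :: "('a::euclidean_space \<Rightarrow> real) \<Rightarrow> 'a \<Rightarrow> real" where
  "F_norm F z = Inf {r. r \<ge> 0 \<and> z \<in> ((*\<^sub>R) r) ` polar (crystal F) }"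

text \<open>Extension of a function on the sphere by 1-homogeneity.\<close>
definition hom_ext :: "('a::real_normed_vector \<Rightarrow> real) \<Rightarrow> 'a \<Rightarrow> real" where
  "hom_ext f x = (if x = 0 then 0 else norm x * f (x /\<^sub>R norm x))"

definition W_op :: "('a::euclidean_space \<Rightarrow> real) \<Rightarrow> 'a \<Rightarrow> real" where
  "W_op F = hom_ext (\<lambda>v. Inf {F w / (v \<bullet> w) | w. norm w = 1 \<and> v \<bullet> w > 0})"

definition A_op :: "('a::euclidean_space \<Rightarrow> real) \<Rightarrow> 'a \<Rightarrow> real" where
  "A_op G = hom_ext (\<lambda>v. Sup {G w * (v \<bullet> w) | w. norm w = 1})"

definition D_op :: "('a::euclidean_space \<Rightarrow> real) \<Rightarrow> 'a \<Rightarrow> real" where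
  "D_op F = A_op (W_op F)"

definition Cont :: "('a::euclidean_space \<Rightarrow> real) \<Rightarrow> 'a set" where
  "Cont F = {x. F x = D_op F x}"

text \<open>Supporting hyperplane of a compact set K associated with a unit vector v.\<close>
definition supp_hyperplane :: "'a::euclidean_space set \<Rightarrow> 'a \<Rightarrow> 'a set" where
  "supp_hyperplane K v = {z. z \<bullet> v = (SUP y\<in>K. y \<bullet> v)}"

end

(* Write h for the support function of the crystal. One checks D_op F = h = F_norm F, and h <= F.
   An absolutely continuous curve is almost everywhere differentiable and is the integral of its
   derivative, so its F-length is at least the integral of <gamma', xbar>, which is
   <vhat, xbar> = h(vhat), with equality iff F(gamma') = <gamma', xbar> almost everywhere; as
   <., xbar> <= h <= F, this is condition (3). The bound is sharp as an infimum: the pairs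
   (displacement, length bound) realised by bounded velocity profiles form a convex cone containing
   the epigraph of F, and separating a point from this cone by a hyperplane yields a point of the
   crystal; so h(vhat) + epsilon is attained for every epsilon > 0. *)
theory Submission
  imports Defs
begin

section \<open>The crystal and its support function\<close>

text \<open>The integrand need not be convex and, being only lower semicontinuous, may be unbounded
  on the sphere. So a segment need not be nearly shortest, lengths may be infinite, and no Jensen
  inequality holds for \<open>F\<close> itself. Concatenation replaces convexity: running two
  velocities one after the other adds both displacements and lengths, whatever the shape of
  \<open>F\<close>. Values close to the infimum are enough, since a geodesic is only compared with
  competitors; no existence of minimizers, hence no compactness, enters. The other obstacle is that
  absolute continuity is given in epsilon-delta form, so the derivative and the integral formula
  have to be built. The variation \<open>V\<close> of the curve over [0,t] is monotone and again
  absolutely continuous, and so is \<open>V\<close> plus any coordinate of the curve. The Stieltjes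
  measure of such a function has no singular part, so Radon-Nikodym gives a density; differences of
  densities are the coordinates of a velocity, which Lebesgue differentiation identifies with the
  derivative almost everywhere.\<close>

lemma integrand_zero:
  assumes "integrand F" shows "F 0 = 0"
  using assms unfolding integrand_def one_homogeneous_def by (metis mult_zero_left order_refl scaleR_zero_left)

lemma integrand_scaleR:
  assumes "integrand F" "r \<ge> 0" shows "F (r *\<^sub>R x) = r * F x"
  using assms unfolding integrand_def one_homogeneous_def by blast

lemma integrand_pos:
  assumes "integrand F" "v \<noteq> 0" shows "F v > 0"
proof -
  have "F v = norm v * F (v /\<^sub>R norm v)"
    using integrand_scaleR[OF assms(1), of "norm v" "v /\<^sub>R norm v"] assms(2) by simp
  moreover have "F (v /\<^sub>R norm v) > 0"
    using assms by (auto simp: integrand_def positive_on_sphere_def)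
  ultimately show ?thesis using assms(2) by simp
qed

lemma integrand_nonneg: "integrand F \<Longrightarrow> F v \<ge> 0"
  using integrand_pos[of F v] integrand_zero[of F] by (cases "v = 0") auto

text \<open>Lower semicontinuity enters here: closed sublevel sets make the integrands of all
  lengths measurable.\<close>

lemma integrand_borel [measurable]:
  fixes F :: "'a::euclidean_space \<Rightarrow> real"
  assumes "integrand F" shows "F \<in> borel_measurable borel"
  using assms by (auto simp: integrand_def lsc_def borel_measurable_iff_le intro: borel_closed)

text \<open>Homogeneity spreads the constraints from unit vectors to all vectors, so the points of
  the crystal are the linear minorants of \<open>F\<close>. This is the form used
  throughout.\<close>

lemma mem_crystal_iff:
  assumes "integrand F"
  shows "x \<in> crystal F \<longleftrightarrow> (\<forall>w. x \<bullet> w \<le> F w)"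
proof
  assume x: "x \<in> crystal F"
  show "\<forall>w. x \<bullet> w \<le> F w"
  proof
    fix w show "x \<bullet> w \<le> F w"
    proof (cases "w = 0")
      case True then show ?thesis using integrand_zero[OF assms] by simp
    next
      case False
      have "x \<bullet> (w /\<^sub>R norm w) \<le> F (w /\<^sub>R norm w)"
        using x False unfolding crystal_def by (auto simp del: inner_scaleR_right)
      then have "norm w * (x \<bullet> (w /\<^sub>R norm w)) \<le> norm w * F (w /\<^sub>R norm w)"
        by (intro mult_left_mono) auto
      also have "\<dots> = F w"
        using integrand_scaleR[OF assms, of "norm w" "w /\<^sub>R norm w"] False by simp
      finally show ?thesis using False by (simp add: mult.assoc[symmetric])
    qed
  qed
qed (auto simp: crystal_def)

lemma zero_in_crystal: "integrand F \<Longrightarrow> 0 \<in> crystal F"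
  by (simp add: mem_crystal_iff integrand_nonneg)

section \<open>Support function of the crystal and gauge of its polar\<close>

definition support_fun :: "('a::euclidean_space \<Rightarrow> real) \<Rightarrow> 'a \<Rightarrow> real" where
  "support_fun F v = (SUP x\<in>crystal F. x \<bullet> v)"

lemma support_fun_upper:
  assumes "integrand F" "x \<in> crystal F" shows "x \<bullet> v \<le> support_fun F v"
  unfolding support_fun_def
  by (intro cSUP_upper assms(2) bdd_aboveI2[where M="F v"]) (use assms mem_crystal_iff in blast)

lemma support_fun_least:
  assumes "integrand F" "\<And>x. x \<in> crystal F \<Longrightarrow> x \<bullet> v \<le> c" shows "support_fun F v \<le> c"
  unfolding support_fun_def using zero_in_crystal[OF assms(1)] assms(2) by (intro cSUP_least) auto

lemma support_fun_le_integrand: "integrand F \<Longrightarrow> support_fun F v \<le> F v"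
  by (intro support_fun_least) (auto simp: mem_crystal_iff)

lemma support_fun_nonneg: "integrand F \<Longrightarrow> 0 \<le> support_fun F v"
  using support_fun_upper[OF _ zero_in_crystal, of F v] by simp

lemma support_fun_scaleR:
  assumes F: "integrand F" and r: "0 < r"
  shows "support_fun F (r *\<^sub>R v) = r * support_fun F v"
proof (rule antisym)
  show "support_fun F (r *\<^sub>R v) \<le> r * support_fun F v"
    using support_fun_upper[OF F, of _ v] r by (intro support_fun_least[OF F]) auto
  have "support_fun F v \<le> support_fun F (r *\<^sub>R v) / r"
    using support_fun_upper[OF F, of _ "r *\<^sub>R v"] r
    by (intro support_fun_least[OF F]) (auto simp: field_simps)
  then show "r * support_fun F v \<le> support_fun F (r *\<^sub>R v)"
    using r by (simp add: field_simps)
qed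

text \<open>For \<open>r > 0\<close>, dividing by \<open>r\<close> shows that \<open>z\<close> lies
  in \<open>r\<close> times the polar iff \<open>x \<bullet> z \<le> r\<close> on the crystal. Hence
  \<open>?R\<close> is the ray above \<open>support_fun F z\<close>, up to the exceptional scale
  \<open>r = 0\<close>, whose image is just {0}.\<close>

lemma F_norm_eq_support_fun:
  assumes F: "integrand F" shows "F_norm F z = support_fun F z"
proof -
  let ?R = "{r. r \<ge> 0 \<and> z \<in> ((*\<^sub>R) r) ` polar (crystal F)}"
  have pos: "r \<in> ?R \<longleftrightarrow> support_fun F z \<le> r" if "r > 0" for r
  proof
    assume "r \<in> ?R"
    then obtain y where y: "y \<in> polar (crystal F)" "z = r *\<^sub>R y" by auto
    have "support_fun F y \<le> 1"
      using y(1) by (intro support_fun_least[OF F]) (auto simp: polar_def inner_commute)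
    then show "support_fun F z \<le> r" using y(2) support_fun_scaleR[OF F that] that by simp
  next
    assume le: "support_fun F z \<le> r"
    have "x \<bullet> z \<le> r" if "x \<in> crystal F" for x
      using support_fun_upper[OF F that, of z] le by simp
    then have "z /\<^sub>R r \<in> polar (crystal F)"
      using that by (auto simp: polar_def inner_commute field_simps)
    moreover have "z = r *\<^sub>R (z /\<^sub>R r)" using that by simp
    ultimately show "r \<in> ?R" using that by (metis (mono_tags, lifting) image_eqI less_imp_le mem_Collect_eq)
  qed
  have lower: "support_fun F z \<le> r" if "r \<in> ?R" for r
  proof (cases "r = 0")
    case True
    then have "z = 0" using that by auto
    then show ?thesis using support_fun_le_integrand[OF F, of 0] integrand_zero[OF F] True by simp
  next
    case False
    then have "r > 0" using that by auto
    then show ?thesis using pos that by blast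
  qed
  have mem: "r \<in> ?R" if "r > support_fun F z" for r
    using pos[of r] that support_fun_nonneg[OF F, of z] by auto
  have ne: "?R \<noteq> {}" using mem[of "support_fun F z + 1"] by (metis empty_iff less_add_one)
  have "Inf ?R = support_fun F z"
  proof (rule antisym)
    show "support_fun F z \<le> Inf ?R" using ne lower by (intro cInf_greatest) auto
    show "Inf ?R \<le> support_fun F z"
    \<comment> \<open>The value is approached from above because \<open>pos\<close> says nothing
      about it when it is 0.\<close>
    proof (rule dense_ge)
      fix r assume "support_fun F z < r"
      from mem[OF this] show "Inf ?R \<le> r"
        using lower by (intro cInf_lower bdd_belowI) auto
    qed
  qed
  then show ?thesis by (simp add: F_norm_def)
qed

section \<open>Radial function of the crystal and convex envelope\<close>

lemma W_op_unit:
  "norm w = 1 \<Longrightarrow> W_op F w = Inf {F u / (w \<bullet> u) | u. norm u = 1 \<and> w \<bullet> u > 0}"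
  by (auto simp: W_op_def hom_ext_def)

lemma W_op_greatest:
  assumes "norm w = 1" "\<And>u. norm u = 1 \<Longrightarrow> w \<bullet> u > 0 \<Longrightarrow> c \<le> F u / (w \<bullet> u)"
  shows "c \<le> W_op F w"
proof -
  \<comment> \<open>\<open>Inf\<close> of the empty set would be an unspecified real;
    \<open>w\<close> itself is an admissible direction.\<close>
  have "{F u / (w \<bullet> u) | u. norm u = 1 \<and> w \<bullet> u > 0} \<noteq> {}"
    using assms(1) by (auto simp: dot_square_norm intro!: exI[of _ w])
  then show ?thesis
    unfolding W_op_unit[OF assms(1)] using assms(2) by (intro cInf_greatest) auto
qed

lemma W_op_lower:
  assumes "integrand F" "norm w = 1" "norm u = 1" "w \<bullet> u > 0"
  shows "W_op F w \<le> F u / (w \<bullet> u)"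
  unfolding W_op_unit[OF assms(2)]
  by (rule cInf_lower) (use assms in \<open>auto intro!: bdd_belowI[of _ 0] divide_nonneg_pos integrand_nonneg[OF assms(1)]\<close>)

text \<open>On the unit sphere, \<^const>\<open>W_op\<close> \<^term>\<open>F\<close> is the radial function of the crystal.\<close>

lemma W_op_scaleR_in_crystal:
  assumes F: "integrand F" and w: "norm w = 1"
  shows "W_op F w *\<^sub>R w \<in> crystal F"
proof -
  have nonneg: "0 \<le> W_op F w"
    using F w by (intro W_op_greatest) (auto intro: integrand_nonneg divide_nonneg_pos)
  have "(W_op F w *\<^sub>R w) \<bullet> u \<le> F u" if u: "norm u = 1" for u
  proof (cases "w \<bullet> u > 0")
    case True
    then show ?thesis using W_op_lower[OF F w u True] by (simp add: field_simps)
  next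
    case False
    then have "W_op F w * (w \<bullet> u) \<le> 0" using nonneg by (simp add: mult_nonneg_nonpos)
    then show ?thesis using integrand_nonneg[OF F, of u] by simp
  qed
  then show ?thesis by (auto simp: crystal_def)
qed

text \<open>Maximality of the radius: each constraint \<open>x \<bullet> u \<le> F u\<close> with
  positive left side, divided by the cosine between \<open>x\<close> and \<open>u\<close>, bounds
  \<open>norm x\<close>.\<close>

lemma norm_le_W_op:
  assumes F: "integrand F" and x: "x \<in> crystal F" "x \<noteq> 0"
  shows "norm x \<le> W_op F (x /\<^sub>R norm x)"
proof (rule W_op_greatest)
  fix u assume u: "norm u = 1" "(x /\<^sub>R norm x) \<bullet> u > 0"
  have "x \<bullet> u \<le> F u" using x F by (simp add: mem_crystal_iff)
  then show "norm x \<le> F u / ((x /\<^sub>R norm x) \<bullet> u)"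
    using u x(2) by (simp add: field_simps)
qed (use x in auto)

text \<open>The points \<open>W_op F w *\<^sub>R w\<close> belong to the crystal and lie farthest
  out in their directions, so maximizing a linear functional over them or over the whole crystal
  gives the same value, as long as that value is approached where the functional is
  positive.\<close>

lemma D_op_eq_support_fun:
  assumes F: "integrand F" shows "D_op F v = support_fun F v"
proof (cases "v = 0")
  case True
  then have "support_fun F v = 0"
    using support_fun_le_integrand[OF F, of 0] support_fun_nonneg[OF F, of 0] integrand_zero[OF F] by simp
  then show ?thesis using True by (simp add: D_op_def A_op_def hom_ext_def)
next
  case False
  define e where "e = v /\<^sub>R norm v"
  have e: "norm e = 1" "v = norm v *\<^sub>R e" using False by (auto simp: e_def)
  let ?S = "{W_op F w * (e \<bullet> w) | w. norm w = 1}"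
  have up: "s \<le> support_fun F e" if "s \<in> ?S" for s
  proof -
    from that obtain w where w: "norm w = 1" "s = W_op F w * (e \<bullet> w)" by blast
    then show ?thesis
      using support_fun_upper[OF F W_op_scaleR_in_crystal[OF F w(1)], of e] by (simp add: inner_commute)
  qed
  have bdd: "bdd_above ?S" using up by (rule bdd_aboveI)
  have "Sup ?S = support_fun F e"
  proof (rule antisym)
    show "Sup ?S \<le> support_fun F e" using up e(1) by (intro cSup_least) auto
    show "support_fun F e \<le> Sup ?S"
    proof (rule support_fun_least[OF F])
      fix x assume x: "x \<in> crystal F"
      show "x \<bullet> e \<le> Sup ?S"
      proof (cases "x \<bullet> e > 0")
        case True
        then have x0: "x \<noteq> 0" by auto
        let ?w = "x /\<^sub>R norm x"
        have "x \<bullet> e = norm x * (?w \<bullet> e)" using x0 by simp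
        also have "\<dots> \<le> W_op F ?w * (?w \<bullet> e)"
          using norm_le_W_op[OF F x x0] True x0 by (intro mult_right_mono) auto
        also have "\<dots> \<le> Sup ?S"
          using x0 by (intro cSup_upper bdd) (auto simp: inner_commute intro!: exI[of _ ?w])
        finally show ?thesis .
      next
        \<comment> \<open>Moving outwards along \<open>x\<close> does not help when
          \<open>x \<bullet> e \<le> 0\<close>; the direction \<open>e\<close> itself already gives
          a nonnegative value.\<close>
        case False
        have "x \<bullet> e \<le> 0" using False by simp
        also have "0 \<le> W_op F e * (e \<bullet> e)"
          using F e(1) by (intro mult_nonneg_nonneg W_op_greatest)
            (auto intro: integrand_nonneg divide_nonneg_pos)
        also have "\<dots> \<le> Sup ?S" using e(1) by (intro cSup_upper bdd) auto
        finally show ?thesis .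
      qed
    qed
  qed
  then have "D_op F v = norm v * support_fun F e"
    using False by (simp add: D_op_def A_op_def hom_ext_def e_def)
  then show ?thesis using support_fun_scaleR[OF F, of "norm v" e] e False by simp
qed

text \<open>In the chain \<open>x \<bullet> v \<le> support_fun F v \<le> F v\<close>, the
  hyperplane condition is equality on the left and membership in \<open>Cont F\<close> is equality
  on the right.\<close>

lemma Cont_hyperplane_iff:
  assumes F: "integrand F" and x: "x \<in> crystal F" and v: "v \<noteq> 0"
  shows "v \<in> Cont F \<and> {z. (z - x) \<bullet> v = 0} = supp_hyperplane (crystal F) (v /\<^sub>R norm v)
         \<longleftrightarrow> F v = x \<bullet> v"
proof -
  have sh: "supp_hyperplane (crystal F) (v /\<^sub>R norm v) = {z. z \<bullet> v = support_fun F v}"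
    using v support_fun_scaleR[OF F, of "inverse (norm v)" v]
    unfolding supp_hyperplane_def support_fun_def[symmetric] by simp
  \<comment> \<open>Two parallel hyperplanes; the left one contains \<open>x\<close>, so they agree
    iff \<open>x\<close> satisfies the equation of the right one.\<close>
  have "{z. (z - x) \<bullet> v = 0} = supp_hyperplane (crystal F) (v /\<^sub>R norm v)
        \<longleftrightarrow> x \<bullet> v = support_fun F v"
    unfolding sh by (auto simp: inner_diff_left)
  moreover have "x \<bullet> v \<le> support_fun F v" "support_fun F v \<le> F v"
    using support_fun_upper[OF F x] support_fun_le_integrand[OF F] by auto
  ultimately show ?thesis by (auto simp: Cont_def D_op_eq_support_fun[OF F])
qed

text \<open>An abstract cone \<open>T\<close> keeps the separation argument apart from integration.
  Weak separation suffices because \<open>c\<close> lies strictly above the support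
  function.\<close>

lemma convex_cone_above_support_fun:
  fixes F :: "'a::euclidean_space \<Rightarrow> real" and T :: "('a \<times> real) set"
  assumes F: "integrand F" and "convex T" and cone: "\<And>c p. c \<ge> 0 \<Longrightarrow> p \<in> T \<Longrightarrow> c *\<^sub>R p \<in> T"
    and epi: "\<And>w r. F w \<le> r \<Longrightarrow> (w, r) \<in> T" and c: "support_fun F v < c"
  shows "(v, c) \<in> T"
proof (rule ccontr)
  assume notin: "(v, c) \<notin> T"
  have T0: "(0, 0) \<in> T" using epi[of 0 0] integrand_zero[OF F] by simp
  obtain a b where a: "a \<noteq> 0" "\<And>p. p \<in> T \<Longrightarrow> a \<bullet> p \<le> b" "a \<bullet> (v, c) \<ge> b"
    using separating_hyperplane_sets[OF \<open>convex T\<close> convex_singleton, of "(v, c)"] notin T0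
    by (metis Int_insert_right_if0 Int_empty_right empty_iff insert_not_empty singletonI)
  obtain y s where ys: "a = (y, s)" by (cases a)
  have b0: "b \<ge> 0" using a(2)[OF T0] ys by simp
  \<comment> \<open>A functional bounded above on a cone is nonpositive there: the factor
    \<open>k\<close> below would push a positive value up to \<open>b + 1\<close>.\<close>
  have le0: "y \<bullet> w + s * r \<le> 0" if "F w \<le> r" for w r
  proof (rule ccontr)
    assume "\<not> ?thesis"
    then have q: "y \<bullet> w + s * r > 0" by simp
    define k where "k = (b + 1) / (y \<bullet> w + s * r)"
    have "k \<ge> 0" using q b0 by (simp add: k_def)
    then have "a \<bullet> (k *\<^sub>R (w, r)) \<le> b" by (intro a(2) cone epi that)
    moreover have "a \<bullet> (k *\<^sub>R (w, r)) = k * (y \<bullet> w + s * r)" by (simp add: ys algebra_simps)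
    ultimately show False using q by (simp add: k_def)
  qed
  \<comment> \<open>The separating hyperplane is not vertical: the epigraph lies over every
    \<open>w\<close>, so with \<open>s = 0\<close> the choice \<open>w = y\<close> forces
    \<open>y = 0\<close>.\<close>
  have "s < 0"
  proof (rule ccontr)
    assume "\<not> s < 0"
    moreover have "s \<le> 0" using le0[of 0 1] integrand_zero[OF F] by simp
    ultimately have s: "s = 0" by simp
    then have "y \<bullet> y \<le> 0" using le0[of y "F y"] by simp
    then have "y = 0" using inner_ge_zero[of y] by (metis antisym inner_eq_zero_iff)
    then show False using a(1) s ys by (simp add: zero_prod_def)
  qed
  \<comment> \<open>Normalizing the vertical coefficient to -1 turns \<open>le0\<close> at
    \<open>r = F w\<close> into a linear minorant of \<open>F\<close>.\<close>
  define x where "x = y /\<^sub>R (- s)"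
  have yx: "y = (- s) *\<^sub>R x" using \<open>s < 0\<close> by (simp add: x_def)
  have "x \<in> crystal F"
  proof -
    have "x \<bullet> w \<le> F w" for w
    proof -
      have "(- s) * (x \<bullet> w) \<le> (- s) * F w" using le0[of w "F w"] yx by simp
      then show ?thesis using \<open>s < 0\<close> by (simp add: mult_le_cancel_left)
    qed
    then show ?thesis by (simp add: mem_crystal_iff[OF F])
  qed
  then have "x \<bullet> v < c" using support_fun_upper[OF F, of x v] c by simp
  then have "(- s) * (x \<bullet> v) < (- s) * c" using \<open>s < 0\<close> by simp
  moreover have "(- s) * (x \<bullet> v) + s * c \<ge> 0" using a(3) b0 by (simp add: ys yx)
  ultimately show False by simp
qed

section \<open>Differentiation of indefinite integrals\<close>

lemma AE_imp_negligible_notin: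
  fixes N :: "real set"
  assumes "negligible N" shows "AE x in lebesgue. x \<notin> N"
  using assms by (simp add: AE_not_in negligible_iff_null_sets)

text \<open>The averages run over cubes with \<open>x\<close> as lower corner, so only the
  right-hand quotient is obtained; reflection will supply the left-hand one.\<close>

lemma AE_right_derivative_integral:
  fixes f :: "real \<Rightarrow> 'b::euclidean_space"
  assumes f: "\<And>a b. f integrable_on {a..b}"
  shows "AE x in lebesgue. ((\<lambda>h. integral {x..x+h} f /\<^sub>R h) \<longlongrightarrow> f x) (at_right 0)"
proof -
  obtain N where N: "negligible N"
    "\<And>x e. \<lbrakk>x \<notin> N; 0 < e\<rbrakk> \<Longrightarrow> \<exists>d>0. \<forall>h. 0 < h \<and> h < d \<longrightarrow>
        norm (integral (cbox x (x + h *\<^sub>R One)) f /\<^sub>R h ^ DIM(real) - f x) < e"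
    by (rule integrable_ccontinuous_explicit[of f]) (use f in auto)
  have "((\<lambda>h. integral {x..x+h} f /\<^sub>R h) \<longlongrightarrow> f x) (at_right 0)" if "x \<notin> N" for x
    unfolding tendsto_iff eventually_at_right_field dist_norm
  proof (intro allI impI)
    fix e :: real assume "0 < e"
    from N(2)[OF that this] obtain d where "d > 0"
      "\<forall>h. 0 < h \<and> h < d \<longrightarrow> norm (integral {x..x+h} f /\<^sub>R h - f x) < e"
      by auto
    then show "\<exists>b>0. \<forall>y>0. y < b \<longrightarrow> norm (integral {x..x + y} f /\<^sub>R y - f x) < e"
      by blast
  qed
  then show ?thesis using AE_imp_negligible_notin[OF N(1)] by (auto elim!: eventually_mono)
qed

text \<open>Reflection is differentiable and therefore preserves null sets.\<close>

lemma AE_lebesgue_uminus: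
  fixes P :: "real \<Rightarrow> bool"
  assumes "AE x in lebesgue. P x" shows "AE x in lebesgue. P (- x)"
proof -
  obtain N where N: "N \<in> null_sets lebesgue" "{x. \<not> P x} \<subseteq> N"
    using assms by (auto simp: eventually_ae_filter)
  have "negligible (uminus ` N)"
    using N(1) by (intro negligible_differentiable_image_negligible)
      (auto simp: negligible_iff_null_sets intro!: derivative_intros)
  then have "AE x in lebesgue. x \<notin> uminus ` N" by (rule AE_imp_negligible_notin)
  then show ?thesis
  proof (rule eventually_mono)
    fix x assume "x \<notin> uminus ` N"
    then have "- x \<notin> N" by (metis add.inverse_inverse image_eqI)
    then show "P (- x)" using N(2) by blast
  qed
qed

theorem AE_has_vector_derivative_integral:
  fixes f :: "real \<Rightarrow> 'b::euclidean_space"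
  assumes f: "\<And>a b. f integrable_on {a..b}"
  shows "AE x in lebesgue. a < x \<longrightarrow> ((\<lambda>t. integral {a..t} f) has_vector_derivative f x) (at x)"
proof -
  have fr: "(\<lambda>x. f (- x)) integrable_on {a..b}" for a b
    using f[of "-b" "-a"] Henstock_Kurzweil_Integration.integrable_reflect_real[where f=f and a="-b" and b="-a"] by simp
  have L: "AE x in lebesgue. ((\<lambda>h. integral {x-h..x} f /\<^sub>R h) \<longlongrightarrow> f x) (at_right 0)"
  proof -
    have "integral {-x..-x+h} (\<lambda>x. f (- x)) = integral {x-h..x} f" for x h
      using Henstock_Kurzweil_Integration.integral_reflect_real[where f=f and a="x - h" and b=x] by (simp del: Henstock_Kurzweil_Integration.integral_reflect_real)
    then show ?thesis
      using AE_lebesgue_uminus[OF AE_right_derivative_integral[OF fr]] by simp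
  qed
  have D: "((\<lambda>t. integral {a..t} f) has_vector_derivative f x) (at x)"
    if x: "a < x" and R: "((\<lambda>h. integral {x..x+h} f /\<^sub>R h) \<longlongrightarrow> f x) (at_right 0)"
      and L: "((\<lambda>h. integral {x-h..x} f /\<^sub>R h) \<longlongrightarrow> f x) (at_right 0)" for x
  proof -
    let ?I = "\<lambda>t. integral {a..t} f"
    let ?q = "\<lambda>h. (?I (x + h) - ?I x) /\<^sub>R h"
    have "(?q \<longlongrightarrow> f x) (at_right 0)"
    proof (rule Lim_transform_eventually[OF R])
      show "\<forall>\<^sub>F h in at_right 0. integral {x..x+h} f /\<^sub>R h = ?q h"
        unfolding eventually_at_right_field
      proof (intro exI[of _ 1] conjI allI impI)
        fix h :: real assume "0 < h"
        then show "integral {x..x+h} f /\<^sub>R h = ?q h"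
          using Henstock_Kurzweil_Integration.integral_combine[of a x "x + h" f] f x
            by (simp add: scaleR_diff_right[symmetric] eq_diff_eq add.commute)
      qed simp
    qed
    moreover have "((\<lambda>h. ?q (- h)) \<longlongrightarrow> f x) (at_right 0)"
    proof (rule Lim_transform_eventually[OF L])
      show "\<forall>\<^sub>F h in at_right 0. integral {x-h..x} f /\<^sub>R h = ?q (- h)"
        unfolding eventually_at_right_field
      \<comment> \<open>This radius keeps \<open>x - h\<close> to the right of \<open>a\<close>, as
        splitting the integral there requires.\<close>
      proof (intro exI[of _ "x - a"] conjI allI impI)
        fix h :: real assume "0 < h" "h < x - a"
        then show "integral {x-h..x} f /\<^sub>R h = ?q (- h)"
          using Henstock_Kurzweil_Integration.integral_combine[of a "x - h" x f] f
            by (simp add: scaleR_diff_right[symmetric] scaleR_minus_right[symmetric] eq_diff_eq add.commute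
                del: scaleR_minus_right)
      qed (use x in simp)
    qed
    then have "(?q \<longlongrightarrow> f x) (at_left 0)" by (simp add: filterlim_at_left_to_right)
    ultimately have "(?q \<longlongrightarrow> f x) (at 0)" by (simp add: filterlim_split_at)
    then have "((\<lambda>h. norm (?q h - f x)) \<longlongrightarrow> 0) (at 0)" by (simp add: LIM_zero tendsto_norm_zero)
    then have "((\<lambda>h. norm (?I (x + h) - ?I x - h *\<^sub>R f x) / norm h) \<longlongrightarrow> 0) (at 0)"
    proof (rule Lim_transform_eventually)
      have "norm (?q h - f x) = norm (?I (x + h) - ?I x - h *\<^sub>R f x) / norm h" if "h \<noteq> 0" for h
      proof -
        have "?q h - f x = (?I (x + h) - ?I x - h *\<^sub>R f x) /\<^sub>R h"
          using that by (simp add: algebra_simps)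
        then show ?thesis by (simp add: divide_inverse mult.commute)
      qed
      then show "\<forall>\<^sub>F h in at 0. norm (?q h - f x) = norm (?I (x + h) - ?I x - h *\<^sub>R f x) / norm h"
        by (auto simp: eventually_at_filter)
    qed
    then show ?thesis
      unfolding has_vector_derivative_def has_derivative_at
      by (simp add: bounded_linear_scaleR_left)
  qed
  show ?thesis
    using AE_right_derivative_integral[OF f] L by eventually_elim (use D in blast)
qed

section \<open>Total variation of absolutely continuous curves\<close>

definition nonoverlapping :: "real \<Rightarrow> real \<Rightarrow> (real \<times> real) set \<Rightarrow> bool" where
  "nonoverlapping a b D \<longleftrightarrow> finite D \<and> (\<forall>(x,y)\<in>D. a \<le> x \<and> x < y \<and> y \<le> b) \<and>
     (\<forall>(x,y)\<in>D. \<forall>(u,v)\<in>D. (x,y) \<noteq> (u,v) \<longrightarrow> {x<..<y} \<inter> {u<..<v} = {})"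

definition variation_sum :: "(real \<Rightarrow> 'a::real_normed_vector) \<Rightarrow> (real \<times> real) set \<Rightarrow> real" where
  "variation_sum \<gamma> D = (\<Sum>(x,y)\<in>D. norm (\<gamma> y - \<gamma> x))"

text \<open>Total variation, with families that may leave gaps in place of partitions: filling gaps
  only increases the sum, and these families fit absolute continuity directly.\<close>

definition variation :: "(real \<Rightarrow> 'a::real_normed_vector) \<Rightarrow> real \<Rightarrow> real \<Rightarrow> real" where
  "variation \<gamma> a b = (SUP D\<in>{D. nonoverlapping a b D}. variation_sum \<gamma> D)"

lemma abs_cont01_iff:
  "abs_cont01 \<gamma> \<longleftrightarrow> (\<forall>\<epsilon>>0. \<exists>\<delta>>0. \<forall>D. nonoverlapping 0 1 D \<longrightarrow>
     (\<Sum>(x,y)\<in>D. y - x) < \<delta> \<longrightarrow> variation_sum \<gamma> D < \<epsilon>)"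
  unfolding abs_cont01_def nonoverlapping_def variation_sum_def by (simp add: imp_conjL)

lemma nonoverlapping_empty [simp]: "nonoverlapping a b {}"
  by (simp add: nonoverlapping_def)

lemma nonoverlapping_mono: "nonoverlapping a b D \<Longrightarrow> c \<le> a \<Longrightarrow> b \<le> d \<Longrightarrow> nonoverlapping c d D"
  unfolding nonoverlapping_def by fastforce

lemma nonoverlappingI:
  assumes "finite D" "\<And>p. p \<in> D \<Longrightarrow> a \<le> fst p \<and> fst p < snd p \<and> snd p \<le> b"
    and "\<And>p q. p \<in> D \<Longrightarrow> q \<in> D \<Longrightarrow> p \<noteq> q \<Longrightarrow> {fst p<..<snd p} \<inter> {fst q<..<snd q} = {}"
  shows "nonoverlapping a b D"
  unfolding nonoverlapping_def case_prod_unfold prod.collapse using assms by blast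

lemma nonoverlapping_disjoint:
  assumes "nonoverlapping a b D" "p \<in> D" "q \<in> D" "p \<noteq> q"
  shows "{fst p<..<snd p} \<inter> {fst q<..<snd q} = {}"
  using assms unfolding nonoverlapping_def by (metis (mono_tags, lifting) case_prod_unfold prod.collapse)

text \<open>Cutting intervals at a point keeps their left ends on one side and their right ends on
  the other; this lemma and its mirror image make both cuts injective.\<close>

lemma nonoverlapping_left_unique:
  assumes "nonoverlapping a b D" "(x, y) \<in> D" "(x, z) \<in> D" shows "y = z"
proof (rule ccontr)
  assume "y \<noteq> z"
  then have "{x<..<y} \<inter> {x<..<z} = {}" using assms unfolding nonoverlapping_def by blast
  moreover have "x < y" "x < z" using assms by (auto simp: nonoverlapping_def)
  then have "(x + min y z) / 2 \<in> {x<..<y} \<inter> {x<..<z}" by (auto simp: min_def)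
  ultimately show False by blast
qed

lemma nonoverlapping_right_unique:
  assumes "nonoverlapping a b D" "(x, z) \<in> D" "(y, z) \<in> D" shows "x = y"
proof (rule ccontr)
  assume "x \<noteq> y"
  then have "{x<..<z} \<inter> {y<..<z} = {}" using assms unfolding nonoverlapping_def by blast
  moreover have "x < z" "y < z" using assms by (auto simp: nonoverlapping_def)
  then have "(max x y + z) / 2 \<in> {x<..<z} \<inter> {y<..<z}" by (auto simp: max_def)
  ultimately show False by blast
qed

text \<open>Lengths are measures of disjoint open intervals, all contained in {a..b}.\<close>

lemma nonoverlapping_total_length:
  assumes D: "nonoverlapping a b D" and "a \<le> b"
  shows "(\<Sum>(x,y)\<in>D. y - x) \<le> b - a"
proof -
  have "(\<Sum>(x,y)\<in>D. y - x) = (\<Sum>p\<in>D. measure lborel {fst p<..<snd p})"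
    using D by (intro sum.cong) (auto simp: nonoverlapping_def)
  also have "\<dots> = measure lborel (\<Union>p\<in>D. {fst p<..<snd p})"
  proof (rule measure_finite_Union[symmetric])
    show "disjoint_family_on (\<lambda>p. {fst p<..<snd p}) D"
      unfolding disjoint_family_on_def using nonoverlapping_disjoint[OF D] by blast
    show "emeasure lborel {fst p<..<snd p} \<noteq> \<infinity>" for p :: "real \<times> real"
      by (cases "fst p \<le> snd p") auto
  qed (use D in \<open>auto simp: nonoverlapping_def\<close>)
  also have "\<dots> \<le> measure lborel {a..b}"
  proof (rule measure_mono_fmeasurable)
    show "(\<Union>p\<in>D. {fst p<..<snd p}) \<subseteq> {a..b}" using D by (fastforce simp: nonoverlapping_def)
    show "(\<Union>p\<in>D. {fst p<..<snd p}) \<in> sets lborel"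
      using D by (intro sets.finite_UN) (auto simp: nonoverlapping_def)
    show "{a..b} \<in> fmeasurable lborel" using \<open>a \<le> b\<close> by (simp add: fmeasurable_def)
  qed
  finally show ?thesis using \<open>a \<le> b\<close> by simp
qed

lemma nonoverlapping_insert:
  assumes D: "nonoverlapping a b D" and "a \<le> b" "b < c"
  shows "nonoverlapping a c (insert (b, c) D)" "(b, c) \<notin> D"
  using assms unfolding nonoverlapping_def by (fastforce, fastforce)

text \<open>Every interval is cut at \<open>b\<close>. Only one that straddles \<open>b\<close> is
  affected, and there the triangle inequality through \<open>\<gamma> b\<close> applies.\<close>

lemma variation_sum_split:
  assumes D: "nonoverlapping a c D"
  obtains D1 D2 where "nonoverlapping a b D1" "nonoverlapping b c D2"
    "variation_sum \<gamma> D \<le> variation_sum \<gamma> D1 + variation_sum \<gamma> D2"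
proof -
  \<comment> \<open>The strict tests discard exactly the intervals that the cut would make empty or
    reversed.\<close>
  define L where "L = {p\<in>D. fst p < b}"
  define R where "R = {p\<in>D. b < snd p}"
  define l where "l = (\<lambda>p::real\<times>real. (fst p, min (snd p) b))"
  define r where "r = (\<lambda>p::real\<times>real. (max (fst p) b, snd p))"
  have fin: "finite D" "finite L" "finite R" using D by (auto simp: nonoverlapping_def L_def R_def)
  have bd: "a \<le> fst p" "fst p < snd p" "snd p \<le> c" if "p \<in> D" for p
    using D that by (auto simp: nonoverlapping_def)
  have subl: "{fst (l p)<..<snd (l p)} \<subseteq> {fst p<..<snd p}" for p by (auto simp: l_def)
  have subr: "{fst (r p)<..<snd (r p)} \<subseteq> {fst p<..<snd p}" for p by (auto simp: r_def)
  have injl: "inj_on l L"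
    by (rule inj_onI) (use nonoverlapping_left_unique[OF D] in \<open>auto simp: l_def L_def\<close>)
  have injr: "inj_on r R"
    by (rule inj_onI) (use nonoverlapping_right_unique[OF D] in \<open>auto simp: r_def R_def\<close>)
  have "nonoverlapping a b (l ` L)"
    proof (rule nonoverlappingI)
    fix p assume "p \<in> l ` L"
    then show "a \<le> fst p \<and> fst p < snd p \<and> snd p \<le> b" using bd by (auto simp: l_def L_def)
  next
    fix p' q' assume "p' \<in> l ` L" "q' \<in> l ` L" "p' \<noteq> q'"
    then obtain p q where "p' = l p" "q' = l q" "p \<in> D" "q \<in> D" "p \<noteq> q" unfolding L_def by blast
    then show "{fst p'<..<snd p'} \<inter> {fst q'<..<snd q'} = {}"
      using nonoverlapping_disjoint[OF D, of p q] subl[of p] subl[of q] by blast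
  qed (use fin in auto)
  moreover have "nonoverlapping b c (r ` R)"
    proof (rule nonoverlappingI)
    fix p assume "p \<in> r ` R"
    then show "b \<le> fst p \<and> fst p < snd p \<and> snd p \<le> c" using bd by (auto simp: r_def R_def)
  next
    fix p' q' assume "p' \<in> r ` R" "q' \<in> r ` R" "p' \<noteq> q'"
    then obtain p q where "p' = r p" "q' = r q" "p \<in> D" "q \<in> D" "p \<noteq> q" unfolding R_def by blast
    then show "{fst p'<..<snd p'} \<inter> {fst q'<..<snd q'} = {}"
      using nonoverlapping_disjoint[OF D, of p q] subr[of p] subr[of q] by blast
  qed (use fin in auto)
  moreover have "variation_sum \<gamma> D \<le> variation_sum \<gamma> (l ` L) + variation_sum \<gamma> (r ` R)"
  proof -
    let ?l = "\<lambda>p. norm (\<gamma> (min (snd p) b) - \<gamma> (fst p))"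
    let ?r = "\<lambda>p. norm (\<gamma> (snd p) - \<gamma> (max (fst p) b))"
    have "variation_sum \<gamma> D \<le> (\<Sum>p\<in>D. (if fst p < b then ?l p else 0) + (if b < snd p then ?r p else 0))"
      unfolding variation_sum_def case_prod_unfold
    proof (rule sum_mono)
      fix p assume "p \<in> D"
      consider "snd p \<le> b" | "b \<le> fst p" | "fst p < b" "b < snd p" by linarith
      then show "norm (\<gamma> (snd p) - \<gamma> (fst p)) \<le> (if fst p < b then ?l p else 0) + (if b < snd p then ?r p else 0)"
      proof cases
        case 3
        then have "min (snd p) b = b" "max (fst p) b = b" by auto
        then show ?thesis
          using 3 norm_triangle_ineq[of "\<gamma> b - \<gamma> (fst p)" "\<gamma> (snd p) - \<gamma> b"] by simp
      qed (use bd[OF \<open>p \<in> D\<close>] in auto)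
    qed
    also have "\<dots> = (\<Sum>p\<in>L. ?l p) + (\<Sum>p\<in>R. ?r p)"
      using fin(1) by (simp add: sum.distrib L_def R_def sum.inter_filter)
    also have "(\<Sum>p\<in>L. ?l p) = variation_sum \<gamma> (l ` L)"
      unfolding variation_sum_def by (subst sum.reindex[OF injl]) (simp add: l_def)
    also have "(\<Sum>p\<in>R. ?r p) = variation_sum \<gamma> (r ` R)"
      unfolding variation_sum_def by (subst sum.reindex[OF injr]) (simp add: r_def)
    finally show ?thesis .
  qed
  ultimately show ?thesis by (rule that)
qed

text \<open>With the modulus for epsilon 1, [0,1] is covered by \<open>n\<close> pieces shorter than
  \<delta>; each contributes less than 1, so \<open>n\<close> is a bound.\<close>

lemma abs_cont01_variation_sum_bounded:
  assumes "abs_cont01 \<gamma>"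
  obtains B where "\<And>D. nonoverlapping 0 1 D \<Longrightarrow> variation_sum \<gamma> D \<le> B"
proof -
  obtain \<delta> where \<delta>: "\<delta> > 0" "\<And>D. nonoverlapping 0 1 D \<Longrightarrow> (\<Sum>(x,y)\<in>D. y - x) < \<delta> \<Longrightarrow> variation_sum \<gamma> D < 1"
    using assms unfolding abs_cont01_iff by (metis zero_less_one)
  obtain n :: nat where n: "n > 0" "1 / real n < \<delta>"
    using \<delta>(1) real_arch_inverse[of \<delta>] by (auto simp: field_simps)
  have "variation_sum \<gamma> D \<le> real k" if "k \<le> n" "nonoverlapping 0 (real k / real n) D" for k D
    using that
  proof (induction k arbitrary: D)
    case 0
    then have "D = {}" by (auto simp: nonoverlapping_def)
    then show ?case by (simp add: variation_sum_def)
  next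
    case (Suc k)
    obtain D1 D2 where D12: "nonoverlapping 0 (real k / real n) D1" "nonoverlapping (real k / real n) (real (Suc k) / real n) D2"
      "variation_sum \<gamma> D \<le> variation_sum \<gamma> D1 + variation_sum \<gamma> D2"
      using variation_sum_split[OF Suc.prems(2)] by metis
    have "(\<Sum>(x,y)\<in>D2. y - x) \<le> 1 / real n"
      using nonoverlapping_total_length[OF D12(2)] n(1) by (simp add: field_simps)
    moreover have "nonoverlapping 0 1 D2"
      using Suc.prems(1) n(1) by (intro nonoverlapping_mono[OF D12(2)]) auto
    ultimately have "variation_sum \<gamma> D2 < 1" using n(2) by (intro \<delta>(2)) auto
    moreover have "variation_sum \<gamma> D1 \<le> real k" using Suc D12(1) by simp
    ultimately show ?case using D12(3) by simp
  qed
  from this[of n] show ?thesis using n(1) that by auto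
qed

section \<open>The variation as a function of its right end point\<close>

context
  fixes \<gamma> :: "real \<Rightarrow> 'a::real_normed_vector"
  assumes ac: "abs_cont01 \<gamma>"
begin

lemma variation_upper:
  assumes "0 \<le> a" "b \<le> 1" "nonoverlapping a b D" shows "variation_sum \<gamma> D \<le> variation \<gamma> a b"
proof -
  obtain B where "\<And>D. nonoverlapping 0 1 D \<Longrightarrow> variation_sum \<gamma> D \<le> B"
    using abs_cont01_variation_sum_bounded[OF ac] by blast
  then show ?thesis
    unfolding variation_def using assms nonoverlapping_mono
    by (intro cSUP_upper bdd_aboveI2[where M=B]) auto
qed

lemma variation_least:
  "(\<And>D. nonoverlapping a b D \<Longrightarrow> variation_sum \<gamma> D \<le> c) \<Longrightarrow> variation \<gamma> a b \<le> c"
  unfolding variation_def using nonoverlapping_empty[of a b]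
  by (intro cSUP_least) (blast, simp)

text \<open>The interval (s,t) can be adjoined to any family inside [0,s].\<close>

lemma norm_le_variation_diff:
  assumes "0 \<le> s" "s \<le> t" "t \<le> 1"
  shows "norm (\<gamma> t - \<gamma> s) \<le> variation \<gamma> 0 t - variation \<gamma> 0 s"
proof (cases "s = t")
  case False
  have "variation \<gamma> 0 s \<le> variation \<gamma> 0 t - norm (\<gamma> t - \<gamma> s)"
  proof (rule variation_least)
    fix D assume D: "nonoverlapping 0 s D"
    have *: "nonoverlapping 0 t (insert (s, t) D)" "(s, t) \<notin> D"
      using nonoverlapping_insert[OF D] False assms by auto
    have "variation_sum \<gamma> (insert (s, t) D) = norm (\<gamma> t - \<gamma> s) + variation_sum \<gamma> D"
      using * by (simp add: variation_sum_def nonoverlapping_def)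
    then show "variation_sum \<gamma> D \<le> variation \<gamma> 0 t - norm (\<gamma> t - \<gamma> s)"
      using variation_upper[OF _ _ *(1)] assms by simp
  qed
  then show ?thesis by simp
qed simp

lemma variation_diff_le:
  assumes "0 \<le> s" "s \<le> t" "t \<le> 1"
  shows "variation \<gamma> 0 t - variation \<gamma> 0 s \<le> variation \<gamma> s t"
proof -
  have "variation \<gamma> 0 t \<le> variation \<gamma> 0 s + variation \<gamma> s t"
  proof (rule variation_least)
    fix D assume "nonoverlapping 0 t D"
    then obtain D1 D2 where "nonoverlapping 0 s D1" "nonoverlapping s t D2"
      "variation_sum \<gamma> D \<le> variation_sum \<gamma> D1 + variation_sum \<gamma> D2"
      by (rule variation_sum_split)
    then show "variation_sum \<gamma> D \<le> variation \<gamma> 0 s + variation \<gamma> s t"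
      using variation_upper[of 0 s D1] variation_upper[of s t D2] assms by simp
  qed
  then show ?thesis by simp
qed

text \<open>Refinement of a family by a family inside each of its intervals. The second claim, which
  lets sums over the union be regrouped, holds because a shared interval would be nonempty and lie
  in two disjoint ones.\<close>

lemma nonoverlapping_UN:
  assumes D: "nonoverlapping 0 1 D" and E: "\<And>p. p \<in> D \<Longrightarrow> nonoverlapping (fst p) (snd p) (E p)"
  shows "nonoverlapping 0 1 (\<Union>p\<in>D. E p)" "\<And>p q. p \<in> D \<Longrightarrow> q \<in> D \<Longrightarrow> p \<noteq> q \<Longrightarrow> E p \<inter> E q = {}"
proof -
  have sub: "fst p \<le> x" "x < y" "y \<le> snd p" if "p \<in> D" "(x, y) \<in> E p" for p x y
    using E[OF that(1)] that(2) by (auto simp: nonoverlapping_def)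
  have dd: "{x<..<y} \<inter> {u<..<v} = {}" if "p \<in> D" "q \<in> D" "p \<noteq> q" "(x, y) \<in> E p" "(u, v) \<in> E q" for p q x y u v
  proof -
    have "{fst p<..<snd p} \<inter> {fst q<..<snd q} = {}"
      using D that(1-3) by (rule nonoverlapping_disjoint)
    moreover have "{x<..<y} \<subseteq> {fst p<..<snd p}" "{u<..<v} \<subseteq> {fst q<..<snd q}"
      using sub[OF that(1,4)] sub[OF that(2,5)] by auto
    ultimately show ?thesis by blast
  qed
  show "E p \<inter> E q = {}" if pq: "p \<in> D" "q \<in> D" "p \<noteq> q" for p q
  proof (rule ccontr)
    assume "E p \<inter> E q \<noteq> {}"
    then obtain x y where xy: "(x, y) \<in> E p" "(x, y) \<in> E q" by auto
    then have "{x<..<y} = {}" using dd[OF pq xy] by blast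
    then show False using sub[OF pq(1) xy(1)] by simp
  qed
  show "nonoverlapping 0 1 (\<Union>p\<in>D. E p)"
    unfolding nonoverlapping_def
  proof (intro conjI)
    show "finite (\<Union>p\<in>D. E p)" using D E by (auto simp: nonoverlapping_def)
    show "\<forall>(x, y)\<in>\<Union>p\<in>D. E p. 0 \<le> x \<and> x < y \<and> y \<le> 1"
    proof clarsimp
      fix x y a b assume ab: "(a, b) \<in> D" "(x, y) \<in> E (a, b)"
      have "0 \<le> a" "b \<le> 1" using D ab(1) by (auto simp: nonoverlapping_def)
      then show "0 \<le> x \<and> x < y \<and> y \<le> 1" using sub[OF ab] by auto
    qed
    have "{x<..<y} \<inter> {u<..<v} = {}"
      if "p \<in> D" "q \<in> D" "(x, y) \<in> E p" "(u, v) \<in> E q" "(x, y) \<noteq> (u, v)" for p q x y u v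
    proof (cases "p = q")
      case True
      then show ?thesis using nonoverlapping_disjoint[OF E[OF that(1)], of "(x, y)" "(u, v)"] that by simp
    next
      case False then show ?thesis using dd that by blast
    qed
    then show "\<forall>(x, y)\<in>\<Union>p\<in>D. E p. \<forall>(u, v)\<in>\<Union>p\<in>D. E p. (x, y) \<noteq> (u, v) \<longrightarrow> {x<..<y} \<inter> {u<..<v} = {}"
      by blast
  qed
qed

text \<open>Inside each interval of a short family a nearly optimal family is chosen. Their union is
  no longer than the original, so the modulus of \<open>\<gamma>\<close> applies to it.\<close>

lemma abs_cont01_variation: "abs_cont01 (variation \<gamma> 0)"
  unfolding abs_cont01_iff
proof (intro allI impI)
  fix \<epsilon> :: real assume e: "\<epsilon> > 0"
  obtain \<delta> where \<delta>: "\<delta> > 0"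
    "\<And>D. nonoverlapping 0 1 D \<Longrightarrow> (\<Sum>(x,y)\<in>D. y - x) < \<delta> \<Longrightarrow> variation_sum \<gamma> D < \<epsilon> / 2"
    using ac e unfolding abs_cont01_iff by (metis half_gt_zero)
  have "variation_sum (variation \<gamma> 0) D < \<epsilon>"
    if D: "nonoverlapping 0 1 D" and len: "(\<Sum>(x,y)\<in>D. y - x) < \<delta>" for D
  proof -
    \<comment> \<open>The loss per interval, at most \<open>\<epsilon> / 2\<close> in total; the
      added 1 covers the empty family.\<close>
    define \<eta> where "\<eta> = \<epsilon> / (2 * (real (card D) + 1))"
    have \<eta>: "\<eta> > 0" using e by (simp add: \<eta>_def)
    have bd: "0 \<le> fst p" "fst p < snd p" "snd p \<le> 1" if "p \<in> D" for p
      using D that by (auto simp: nonoverlapping_def)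
    have "\<exists>E. nonoverlapping (fst p) (snd p) E \<and> variation \<gamma> (fst p) (snd p) - \<eta> \<le> variation_sum \<gamma> E" for p
    proof (rule ccontr)
      assume "\<not> ?thesis"
      then have "variation \<gamma> (fst p) (snd p) \<le> variation \<gamma> (fst p) (snd p) - \<eta>"
        by (intro variation_least) (meson linorder_not_le order_less_imp_le)
      then show False using \<eta> by simp
    qed
    then obtain E where E: "\<And>p. nonoverlapping (fst p) (snd p) (E p)"
      "\<And>p. variation \<gamma> (fst p) (snd p) - \<eta> \<le> variation_sum \<gamma> (E p)" by metis
    note U = nonoverlapping_UN[OF D E(1)]
    have fin: "finite D" "\<And>p. finite (E p)" using D E(1) by (auto simp: nonoverlapping_def)
    have "(\<Sum>(x,y)\<in>(\<Union>p\<in>D. E p). y - x) = (\<Sum>p\<in>D. \<Sum>(x,y)\<in>E p. y - x)"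
      by (intro sum.UNION_disjoint) (use fin U(2) in auto)
    also have "\<dots> \<le> (\<Sum>p\<in>D. snd p - fst p)"
      by (intro sum_mono nonoverlapping_total_length E) (use bd in force)
    also have "\<dots> < \<delta>" using len by (simp add: case_prod_unfold)
    finally have "variation_sum \<gamma> (\<Union>p\<in>D. E p) < \<epsilon> / 2" by (intro \<delta>(2) U(1))
    moreover have "variation_sum \<gamma> (\<Union>p\<in>D. E p) = (\<Sum>p\<in>D. variation_sum \<gamma> (E p))"
      unfolding variation_sum_def by (intro sum.UNION_disjoint) (use fin U(2) in auto)
    moreover have "variation_sum (variation \<gamma> 0) D \<le> (\<Sum>p\<in>D. variation_sum \<gamma> (E p) + \<eta>)"
      unfolding variation_sum_def[of _ D] case_prod_unfold
    proof (rule sum_mono)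
      fix p assume "p \<in> D"
      note p = bd[OF this]
      have "0 \<le> variation \<gamma> 0 (snd p) - variation \<gamma> 0 (fst p)"
        using norm_le_variation_diff[of "fst p" "snd p"] p
        by (meson norm_ge_zero order_trans less_imp_le)
      moreover have "variation \<gamma> 0 (snd p) - variation \<gamma> 0 (fst p) \<le> variation_sum \<gamma> (E p) + \<eta>"
        using variation_diff_le[of "fst p" "snd p"] p E(2)[of p] by simp
      ultimately show "norm (variation \<gamma> 0 (snd p) - variation \<gamma> 0 (fst p)) \<le> variation_sum \<gamma> (E p) + \<eta>"
        by simp
    qed
    moreover have "(\<Sum>p\<in>D. variation_sum \<gamma> (E p) + \<eta>) \<le> (\<Sum>p\<in>D. variation_sum \<gamma> (E p)) + \<epsilon> / 2"
    proof -
      have "real (card D) * \<eta> \<le> (real (card D) + 1) * \<eta>" using \<eta> by simp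
      also have "\<dots> = \<epsilon> / 2" by (simp add: \<eta>_def field_simps)
      finally show ?thesis by (simp add: sum.distrib)
    qed
    ultimately show ?thesis by linarith
  qed
  then show "\<exists>\<delta>>0. \<forall>D. nonoverlapping 0 1 D \<longrightarrow> (\<Sum>(x,y)\<in>D. y - x) < \<delta> \<longrightarrow>
      variation_sum (variation \<gamma> 0) D < \<epsilon>"
    using \<delta>(1) by blast
qed

end

section \<open>The fundamental theorem of calculus for absolutely continuous curves\<close>

text \<open>Bounds the Stieltjes mass of a finite union of intervals by the modulus of
  \<open>p\<close>. The clamp \<open>c\<close> carries intervals of the line into [0,1] without
  lengthening them.\<close>

lemma variation_sum_mono_on_division:
  fixes p :: "real \<Rightarrow> real"
  defines "c \<equiv> \<lambda>x::real. max 0 (min 1 x)"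
  assumes mono: "mono_on {0..1} p" and div: "\<D> division_of C"
    and \<delta>: "\<And>D. nonoverlapping 0 1 D \<Longrightarrow> (\<Sum>(x,y)\<in>D. y - x) < \<delta> \<Longrightarrow> variation_sum p D < \<epsilon>"
    and C: "measure lebesgue C < \<delta>"
  shows "(\<Sum>k\<in>\<D>. p (c (Sup k)) - p (c (Inf k))) < \<epsilon>"
proof -
  note d = division_ofD[OF div]
  define pr where "pr k = (c (Inf k), c (Sup k))" for k
  \<comment> \<open>Pieces collapsed by the clamp carry no increment and would violate the strict
    order in \<open>nonoverlapping\<close>.\<close>
  define \<D>' where "\<D>' = {k\<in>\<D>. c (Inf k) < c (Sup k)}"
  have k: "k = {Inf k..Sup k}" "Inf k \<le> Sup k" if "k \<in> \<D>" for k
  proof -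
    from d(3,4)[OF that] obtain a b where "k = {a..b}" "a \<le> b" by auto
    then show "k = {Inf k..Sup k}" "Inf k \<le> Sup k" by auto
  qed
  have c_mono: "c x \<le> c y" if "x \<le> y" for x y using that by (auto simp: c_def)
  have fin: "finite \<D>" "finite \<D>'" using d(1) by (auto simp: \<D>'_def)
  have disj: "{fst (pr k)<..<snd (pr k)} \<inter> {fst (pr l)<..<snd (pr l)} = {}"
    if "k \<in> \<D>" "l \<in> \<D>" "k \<noteq> l" for k l
  proof -
    have "{fst (pr k)<..<snd (pr k)} \<subseteq> interior k" if "k \<in> \<D>" for k
    proof -
      from d(3,4)[OF that] obtain a b where ab: "k = {a..b}" "a \<le> b" by auto
      show ?thesis unfolding ab(1) pr_def c_def using ab(2) by auto
    qed
    then show ?thesis using d(5)[OF that] that by blast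
  qed
  have inj: "inj_on pr \<D>'"
  proof (rule inj_onI, rule ccontr)
    fix k l assume kl: "k \<in> \<D>'" "l \<in> \<D>'" "pr k = pr l" "k \<noteq> l"
    then have "{fst (pr k)<..<snd (pr k)} = {}" using disj[of k l] by (auto simp: \<D>'_def)
    then show False using kl(1) by (auto simp: \<D>'_def pr_def)
  qed
  have no: "nonoverlapping 0 1 (pr ` \<D>')"
  proof (rule nonoverlappingI)
    fix q assume "q \<in> pr ` \<D>'"
    then show "0 \<le> fst q \<and> fst q < snd q \<and> snd q \<le> 1" by (auto simp: pr_def \<D>'_def c_def)
  next
    fix q q' assume "q \<in> pr ` \<D>'" "q' \<in> pr ` \<D>'" "q \<noteq> q'"
    then obtain k l where "q = pr k" "q' = pr l" "k \<in> \<D>" "l \<in> \<D>" "k \<noteq> l" unfolding \<D>'_def by blast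
    then show "{fst q<..<snd q} \<inter> {fst q'<..<snd q'} = {}" using disj by blast
  qed (use fin in auto)
  have "(\<Sum>(x,y)\<in>pr ` \<D>'. y - x) = (\<Sum>k\<in>\<D>'. c (Sup k) - c (Inf k))"
    by (subst sum.reindex[OF inj]) (simp add: pr_def)
  also have "\<dots> \<le> (\<Sum>k\<in>\<D>. c (Sup k) - c (Inf k))"
    using k(2) c_mono by (intro sum_mono2) (auto simp: fin \<D>'_def)
  also have "\<dots> \<le> (\<Sum>k\<in>\<D>. measure lebesgue k)"
  proof (rule sum_mono)
    fix l assume "l \<in> \<D>"
    have "measure lebesgue l = Sup l - Inf l"
      using k[OF \<open>l \<in> \<D>\<close>] by (metis content_real measure_completion sets_lborel atLeastAtMost_borel)
    moreover have "c (Sup l) - c (Inf l) \<le> Sup l - Inf l" using k(2)[OF \<open>l \<in> \<D>\<close>] by (auto simp: c_def)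
    ultimately show "c (Sup l) - c (Inf l) \<le> measure lebesgue l" by simp
  qed
  also have "\<dots> < \<delta>" using C content_division[OF div] by simp
  finally have "variation_sum p (pr ` \<D>') < \<epsilon>" by (intro \<delta>[OF no])
  moreover have "variation_sum p (pr ` \<D>') = (\<Sum>k\<in>\<D>'. \<bar>p (c (Sup k)) - p (c (Inf k))\<bar>)"
    unfolding variation_sum_def by (subst sum.reindex[OF inj]) (simp add: pr_def)
  moreover have "(\<Sum>k\<in>\<D>. p (c (Sup k)) - p (c (Inf k))) = (\<Sum>k\<in>\<D>'. p (c (Sup k)) - p (c (Inf k)))"
  proof (rule sum.mono_neutral_right)
    show "\<forall>k\<in>\<D> - \<D>'. p (c (Sup k)) - p (c (Inf k)) = 0"
      using k(2) c_mono by (fastforce simp: \<D>'_def not_less intro: antisym)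
  qed (auto simp: fin \<D>'_def)
  moreover have "\<dots> \<le> (\<Sum>k\<in>\<D>'. \<bar>p (c (Sup k)) - p (c (Inf k))\<bar>)" by (intro sum_mono) auto
  ultimately show ?thesis by simp
qed

lemma abs_cont01_continuous_on:
  assumes "abs_cont01 \<gamma>" shows "continuous_on {0..1} \<gamma>"
  unfolding continuous_on_iff
proof (intro ballI allI impI)
  fix x \<epsilon> :: real assume x: "x \<in> {0..1}" and "0 < \<epsilon>"
  then obtain \<delta> where \<delta>: "\<delta> > 0"
    "\<And>D. nonoverlapping 0 1 D \<Longrightarrow> (\<Sum>(x,y)\<in>D. y - x) < \<delta> \<Longrightarrow> variation_sum \<gamma> D < \<epsilon>"
    using assms unfolding abs_cont01_iff by metis
  have *: "norm (\<gamma> b - \<gamma> a) < \<epsilon>" if "0 \<le> a" "a < b" "b \<le> 1" "b - a < \<delta>" for a b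
    using \<delta>(2)[of "{(a, b)}"] that by (simp add: nonoverlapping_def variation_sum_def)
  have "dist (\<gamma> y) (\<gamma> x) < \<epsilon>" if "y \<in> {0..1}" "dist y x < \<delta>" for y
    using *[of x y] *[of y x] x that \<open>0 < \<epsilon>\<close>
    by (cases x y rule: linorder_cases) (auto simp: dist_norm norm_minus_commute)
  then show "\<exists>d>0. \<forall>y\<in>{0..1}. dist y x < d \<longrightarrow> dist (\<gamma> y) (\<gamma> x) < \<epsilon>" using \<delta>(1) by blast
qed

text \<open>A Lebesgue null set has open neighbourhoods of arbitrarily small length, whose Stieltjes
  mass is then small by the modulus of \<open>p\<close>. So the Stieltjes measure is absolutely
  continuous and has a Radon-Nikodym density.\<close>

lemma mono_abs_cont01_density:
  fixes p :: "real \<Rightarrow> real"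
  assumes mono: "mono_on {0..1} p" and ac: "abs_cont01 p"
  obtains g where "integrable lborel g" "\<And>a b. 0 \<le> a \<Longrightarrow> a \<le> b \<Longrightarrow> b \<le> 1 \<Longrightarrow> (g has_integral (p b - p a)) {a..b}"
proof -
  \<comment> \<open>Extends \<open>p\<close> to the line by constants, so that no mass sits outside
    [0,1].\<close>
  define c where "c x = max 0 (min 1 x)" for x :: real
  define P where "P x = p (c x)" for x
  have c01: "c x \<in> {0..1}" for x by (auto simp: c_def)
  have P_mono: "P x \<le> P y" if "x \<le> y" for x y
    unfolding P_def using that by (intro mono_onD[OF mono c01 c01]) (auto simp: c_def)
  have P_cont: "continuous_on UNIV P"
    unfolding P_def
  proof (rule continuous_on_compose2[OF abs_cont01_continuous_on[OF ac]])
    show "continuous_on UNIV c" unfolding c_def by (intro continuous_intros)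
  qed (use c01 in auto)
  define \<mu> where "\<mu> = interval_measure P"
  have sets\<mu> [measurable_cong, simp]: "sets \<mu> = sets borel" by (simp add: \<mu>_def)
  have \<mu>_Icc: "emeasure \<mu> {a..b} = ennreal (P b - P a)" if "a \<le> b" for a b
    unfolding \<mu>_def using that P_mono P_cont by (intro emeasure_interval_measure_Icc) auto
  have "absolutely_continuous lborel \<mu>"
    unfolding absolutely_continuous_def
  proof
    fix A :: "real set" assume "A \<in> null_sets lborel"
    then have A: "A \<in> sets borel" "emeasure lborel A = 0" by (auto simp: null_sets_def)
    have small: "emeasure \<mu> A \<le> ennreal \<epsilon>" if pos: "\<epsilon> > 0" for \<epsilon>
    proof -
      obtain \<delta> where \<delta>: "\<delta> > 0"
        "\<And>D. nonoverlapping 0 1 D \<Longrightarrow> (\<Sum>(x,y)\<in>D. y - x) < \<delta> \<Longrightarrow> variation_sum p D < \<epsilon>"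
        using ac pos unfolding abs_cont01_iff by metis
      obtain U where U: "open U" "A \<subseteq> U" "emeasure lborel (U - A) < \<delta>"
        using outer_regular_lborel[OF A(1) \<delta>(1)] by blast
      have [measurable]: "U \<in> sets borel" using U(1) by simp
      have "emeasure lborel U \<le> emeasure lborel (U - A) + emeasure lborel A"
        using A(1) U(2) emeasure_subadditive[of "U - A" lborel A] by (simp add: Un_absorb2)
      then have Ud: "emeasure lborel U < \<delta>" using U(3) A(2) by simp
      obtain \<C> where \<C>: "countable \<C>" "\<C> \<subseteq> Pow U" "\<And>X. X \<in> \<C> \<Longrightarrow> \<exists>a b. X = cbox a b" "\<Union>\<C> = U"
        using open_countable_Union_open_cbox[OF U(1)] by blast
      \<comment> \<open>The modulus controls finite families only, and boxes may overlap; hence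
        finite unions, recut into a division.\<close>
      have fin: "emeasure \<mu> (\<Union>\<F>) \<le> ennreal \<epsilon>" if \<F>: "finite \<F>" "\<F> \<subseteq> \<C>" for \<F>
      proof -
        obtain \<D> where div: "\<D> division_of \<Union>\<F>"
          using elementary_unions_intervals[OF \<F>(1)] \<F>(2) \<C>(3) by blast
        note d = division_ofD[OF div]
        have ku: "\<exists>a b. k = {a..b} \<and> a \<le> b" if "k \<in> \<D>" for k using d(3,4)[OF that] by auto
        have meas: "\<D> \<subseteq> sets borel" using ku by force
        have sub: "\<Union>\<F> \<subseteq> U" using \<F>(2) \<C>(4) by blast
        have bU: "\<Union>\<F> \<in> sets borel" using meas d(1,6) by (metis sets.finite_Union)
        have "ennreal (measure lebesgue (\<Union>\<F>)) \<le> emeasure lborel (\<Union>\<F>)"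
          using bU by (simp add: measure_def ennreal_enn2real_if)
        also have "\<dots> \<le> emeasure lborel U" using sub by (intro emeasure_mono) auto
        also note Ud
        finally have lt: "measure lebesgue (\<Union>\<F>) < \<delta>" by (simp add: ennreal_less_iff)
        have "emeasure \<mu> (\<Union>\<F>) = emeasure \<mu> (\<Union>k\<in>\<D>. k)" using d(6) by simp
        also have "\<dots> \<le> (\<Sum>k\<in>\<D>. emeasure \<mu> k)"
          using d(1) meas by (intro emeasure_subadditive_finite) auto
        also have "\<dots> = (\<Sum>k\<in>\<D>. ennreal (p (c (Sup k)) - p (c (Inf k))))"
          using ku by (intro sum.cong) (auto simp: \<mu>_Icc P_def dest!: ku)
        also have "\<dots> = ennreal (\<Sum>k\<in>\<D>. p (c (Sup k)) - p (c (Inf k)))"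
        proof (rule sum_ennreal)
          fix k assume "k \<in> \<D>"
          then have "Inf k \<le> Sup k" using ku by fastforce
          then show "0 \<le> p (c (Sup k)) - p (c (Inf k))" using P_mono by (simp add: P_def)
        qed
        also have "\<dots> \<le> ennreal \<epsilon>"
          using variation_sum_mono_on_division[OF mono div \<delta>(2) lt]
          by (intro ennreal_leI) (simp add: c_def)
        finally show ?thesis .
      qed
      have "emeasure \<mu> U \<le> ennreal \<epsilon>"
      proof (cases "\<C> = {}")
        case True then show ?thesis using \<C>(4) by auto
      next
        case False
        \<comment> \<open>Increasing partial unions: continuity from below carries the bound over to
          \<open>U\<close>.\<close>
        let ?S = "\<lambda>n. \<Union>(from_nat_into \<C> ` {..n})"
        have Sb: "?S n \<in> sets borel" for n
        proof (rule sets.finite_Union)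
          show "from_nat_into \<C> ` {..n} \<subseteq> sets borel"
          proof
            fix X assume "X \<in> from_nat_into \<C> ` {..n}"
            then have "X \<in> \<C>" using from_nat_into[OF False] by blast
            from \<C>(3)[OF this] show "X \<in> sets borel" by auto
          qed
        qed simp
        have "emeasure \<mu> (\<Union>n. ?S n) = (SUP n. emeasure \<mu> (?S n))"
        proof (rule SUP_emeasure_incseq[symmetric])
          show "range ?S \<subseteq> sets \<mu>" using Sb by (simp add: image_subset_iff)
          show "incseq ?S" unfolding incseq_def by (intro allI impI Union_mono image_mono) simp
        qed
        also have "\<dots> \<le> ennreal \<epsilon>"
          using from_nat_into[OF False] by (intro SUP_least fin) (simp_all add: image_subset_iff)
        also have "(\<Union>n. ?S n) = \<Union>\<C>"
        proof -
          have "(\<Union>n. ?S n) = \<Union>(range (from_nat_into \<C>))" by auto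
          then show ?thesis using range_from_nat_into[OF False \<C>(1)] by simp
        qed
        finally show ?thesis using \<C>(4) by simp
      qed
      moreover have "emeasure \<mu> A \<le> emeasure \<mu> U" using U(2) by (intro emeasure_mono) auto
      ultimately show ?thesis by simp
    qed
    have "emeasure \<mu> A \<le> 0"
      by (rule ennreal_le_epsilon) (use small in simp)
    then show "A \<in> null_sets \<mu>" using A(1) by (auto simp: null_sets_def)
  qed
  then obtain f where f: "f \<in> borel_measurable lborel" "density lborel f = \<mu>"
    using sigma_finite_measure.Radon_Nikodym[OF sigma_finite_lborel, of \<mu>] by auto
  have fI: "(\<integral>\<^sup>+x. f x * indicator {a..b} x \<partial>lborel) = ennreal (p b - p a)" if "0 \<le> a" "a \<le> b" "b \<le> 1" for a b
  proof -
    have "(\<integral>\<^sup>+x. f x * indicator {a..b} x \<partial>lborel) = emeasure \<mu> {a..b}"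
      using f by (simp add: emeasure_density[symmetric])
    also have "\<dots> = ennreal (p b - p a)" using that by (simp add: \<mu>_Icc P_def c_def)
    finally show ?thesis .
  qed
  have fm [measurable]: "f \<in> borel_measurable borel" using f(1) by simp
  \<comment> \<open>The finite mass of [0,1] makes \<open>f\<close> finite almost everywhere there,
    so passing to reals changes no integral.\<close>
  define g where "g x = enn2real (f x * indicator {0..1} x)" for x
  have gm [measurable]: "g \<in> borel_measurable borel" unfolding g_def by measurable
  have "AE x in lborel. f x * indicator {0..1} x \<noteq> \<infinity>"
    using fI[of 0 1] by (intro nn_integral_PInf_AE) auto
  then have ae: "AE x in lborel. ennreal (g x) = f x * indicator {0..1} x"
    by eventually_elim (simp add: g_def less_top)
  have gI: "(\<integral>\<^sup>+x. ennreal (g x * indicator {a..b} x) \<partial>lborel) = ennreal (p b - p a)"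
    if "0 \<le> a" "a \<le> b" "b \<le> 1" for a b
  proof -
    have "(\<integral>\<^sup>+x. ennreal (g x * indicator {a..b} x) \<partial>lborel) = (\<integral>\<^sup>+x. f x * indicator {a..b} x \<partial>lborel)"
      using ae that by (intro nn_integral_cong_AE) (auto elim!: eventually_mono simp: indicator_def)
    then show ?thesis using fI that by simp
  qed
  show ?thesis
  proof (rule that)
    have "(\<integral>\<^sup>+x. ennreal (norm (g x)) \<partial>lborel) = (\<integral>\<^sup>+x. ennreal (g x * indicator {0..1} x) \<partial>lborel)"
      by (intro nn_integral_cong) (auto simp: g_def indicator_def)
    then show "integrable lborel g" using gI[of 0 1] by (intro integrableI_bounded) auto
    fix a b :: real assume ab: "0 \<le> a" "a \<le> b" "b \<le> 1"
    have "((\<lambda>x. g x * indicator {a..b} x) has_integral (p b - p a)) UNIV"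
      using gI[OF ab] mono_onD[OF mono, of a b] ab
      by (intro nn_integral_has_integral) (auto simp: g_def)
    then have "((\<lambda>x. if x \<in> {a..b} then g x else 0) has_integral (p b - p a)) UNIV"
      by (rule has_integral_eq[rotated]) auto
    then show "(g has_integral (p b - p a)) {a..b}"
      by (simp only: has_integral_restrict_UNIV)
  qed
qed

lemma abs_cont01_dominated:
  assumes V: "abs_cont01 (V :: real \<Rightarrow> real)" and C: "C > 0"
    and le: "\<And>x y. 0 \<le> x \<Longrightarrow> x < y \<Longrightarrow> y \<le> 1 \<Longrightarrow> norm (p y - p x) \<le> C * \<bar>V y - V x\<bar>"
  shows "abs_cont01 p"
  unfolding abs_cont01_iff
proof (intro allI impI)
  fix \<epsilon> :: real assume "\<epsilon> > 0"
  then obtain \<delta> where \<delta>: "\<delta> > 0"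
    "\<And>D. nonoverlapping 0 1 D \<Longrightarrow> (\<Sum>(x,y)\<in>D. y - x) < \<delta> \<Longrightarrow> variation_sum V D < \<epsilon> / C"
    using V C unfolding abs_cont01_iff by (metis divide_pos_pos)
  have "variation_sum p D < \<epsilon>" if D: "nonoverlapping 0 1 D" "(\<Sum>(x,y)\<in>D. y - x) < \<delta>" for D
  proof -
    have "variation_sum p D \<le> (\<Sum>(x,y)\<in>D. C * norm (V y - V x))"
      unfolding variation_sum_def using D(1) le by (intro sum_mono) (auto simp: nonoverlapping_def)
    also have "\<dots> = C * variation_sum V D"
      by (simp add: variation_sum_def sum_distrib_left case_prod_unfold)
    also have "\<dots> < \<epsilon>" using \<delta>(2)[OF D] C by (simp add: field_simps)
    finally show ?thesis .
  qed
  then show "\<exists>\<delta>>0. \<forall>D. nonoverlapping 0 1 D \<longrightarrow> (\<Sum>(x,y)\<in>D. y - x) < \<delta> \<longrightarrow> variation_sum p D < \<epsilon>"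
    using \<delta>(1) by blast
qed

text \<open>\<open>V\<close> increases at least as fast as any coordinate of the curve varies, so
  each \<open>V t + \<gamma> t \<bullet> i\<close> is monotone, with increments at most twice those
  of \<open>V\<close>. Coordinates are thus differences of functions that have densities.\<close>

theorem abs_cont01_FTC:
  fixes \<gamma> :: "real \<Rightarrow> 'a::euclidean_space"
  assumes ac: "abs_cont01 \<gamma>"
  obtains g where "integrable lborel g" "(g has_integral (\<gamma> 1 - \<gamma> 0)) {0..1}"
    "AE t in lebesgue. t \<in> {0<..<1} \<longrightarrow> (\<gamma> has_vector_derivative g t) (at t)"
proof -
  define V where "V = variation \<gamma> 0"
  have V: "norm (\<gamma> t - \<gamma> s) \<le> V t - V s" if "0 \<le> s" "s \<le> t" "t \<le> 1" for s t
    unfolding V_def by (rule norm_le_variation_diff[OF ac that])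
  have V_mono: "V s \<le> V t" if "0 \<le> s" "s \<le> t" "t \<le> 1" for s t
    using V[OF that] norm_ge_zero[of "\<gamma> t - \<gamma> s"] by linarith
  have acV: "abs_cont01 V" unfolding V_def by (rule abs_cont01_variation[OF ac])
  have "mono_on {0..1} V" using V_mono by (intro mono_onI) auto
  then obtain gV where gV: "integrable lborel gV"
    "\<And>a b. 0 \<le> a \<Longrightarrow> a \<le> b \<Longrightarrow> b \<le> 1 \<Longrightarrow> (gV has_integral (V b - V a)) {a..b}"
    using mono_abs_cont01_density[OF _ acV] by blast
  have "\<exists>g. integrable lborel g \<and>
    (\<forall>a b. 0 \<le> a \<longrightarrow> a \<le> b \<longrightarrow> b \<le> 1 \<longrightarrow> (g has_integral (V b + \<gamma> b \<bullet> i - (V a + \<gamma> a \<bullet> i))) {a..b})"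
    if i: "i \<in> Basis" for i
  proof -
    let ?p = "\<lambda>t. V t + \<gamma> t \<bullet> i"
    have bnd: "\<bar>(\<gamma> t - \<gamma> s) \<bullet> i\<bar> \<le> V t - V s" if "0 \<le> s" "s \<le> t" "t \<le> 1" for s t
      using Basis_le_norm[OF i, of "\<gamma> t - \<gamma> s"] V[OF that] by linarith
    have m: "mono_on {0..1} ?p"
    proof (rule mono_onI)
      fix s t :: real assume "s \<in> {0..1}" "t \<in> {0..1}" "s \<le> t"
      then show "?p s \<le> ?p t" using bnd[of s t] by (auto simp: inner_diff_left)
    qed
    have a: "abs_cont01 ?p"
    proof (rule abs_cont01_dominated[OF acV, of 2])
      fix x y :: real assume "0 \<le> x" "x < y" "y \<le> 1"
      then show "norm (?p y - ?p x) \<le> 2 * \<bar>V y - V x\<bar>"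
        using bnd[of x y] by (auto simp: inner_diff_left)
    qed simp
    show ?thesis by (rule mono_abs_cont01_density[OF m a]) blast
  qed
  then obtain G where G: "\<And>i. i \<in> Basis \<Longrightarrow> integrable lborel (G i)"
    "\<And>i a b. i \<in> Basis \<Longrightarrow> 0 \<le> a \<Longrightarrow> a \<le> b \<Longrightarrow> b \<le> 1 \<Longrightarrow>
      (G i has_integral (V b + \<gamma> b \<bullet> i - (V a + \<gamma> a \<bullet> i))) {a..b}"
    by metis
  define g where "g t = (\<Sum>i\<in>Basis. (G i t - gV t) *\<^sub>R i)" for t
  have int: "integrable lborel g"
    unfolding g_def using G(1) gV(1) by (intro Bochner_Integration.integrable_sum integrable_scaleR_left Bochner_Integration.integrable_diff) auto
  have gI: "(g has_integral (\<gamma> b - \<gamma> a)) {a..b}" if ab: "0 \<le> a" "a \<le> b" "b \<le> 1" for a b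
  proof -
    have "(g has_integral (\<Sum>i\<in>Basis. ((V b + \<gamma> b \<bullet> i - (V a + \<gamma> a \<bullet> i)) - (V b - V a)) *\<^sub>R i)) {a..b}"
      unfolding g_def using G(2) gV(2) ab
      by (intro has_integral_sum has_integral_scaleR_left has_integral_diff) auto
    also have "(\<Sum>i\<in>Basis. ((V b + \<gamma> b \<bullet> i - (V a + \<gamma> a \<bullet> i)) - (V b - V a)) *\<^sub>R i)
        = (\<Sum>i\<in>Basis. ((\<gamma> b - \<gamma> a) \<bullet> i) *\<^sub>R i)"
      by (intro sum.cong) (auto simp: algebra_simps)
    also have "\<dots> = \<gamma> b - \<gamma> a" by (rule euclidean_representation)
    finally show ?thesis .
  qed
  have on: "g integrable_on {a..b}" for a b
    using integrable_on_lborel[OF int] by (rule integrable_on_subcbox[where 'n=real, unfolded box_real]) auto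
  have "AE t in lebesgue. t \<in> {0<..<1} \<longrightarrow> (\<gamma> has_vector_derivative g t) (at t)"
    using AE_has_vector_derivative_integral[OF on, of 0]
  proof (rule eventually_mono, intro impI)
    fix t :: real
    assume D: "0 < t \<longrightarrow> ((\<lambda>t. integral {0..t} g) has_vector_derivative g t) (at t)" and t: "t \<in> {0<..<1}"
    have "((\<lambda>t. \<gamma> 0 + integral {0..t} g) has_vector_derivative g t) (at t)"
      using D t by (auto intro!: derivative_eq_intros)
    then show "(\<gamma> has_vector_derivative g t) (at t)"
    \<comment> \<open>The integral formula for \<open>\<gamma>\<close> holds only inside [0,1], so
      the derivative is transferred on the open interval.\<close>
    proof (rule has_vector_derivative_transform_within_open[where S="{0<..<1}"])
      fix s :: real assume "s \<in> {0<..<1}"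
      then show "\<gamma> 0 + integral {0..s} g = \<gamma> s" using gI[of 0 s] by (simp add: integral_unique)
    qed (use t in auto)
  qed
  then show ?thesis using int gI[of 0 1] that by simp
qed

section \<open>Curves of almost minimal length\<close>

lemma abs_cont01_Lipschitz:
  fixes \<rho> :: "real \<Rightarrow> 'a::real_normed_vector"
  assumes L: "\<And>x y. 0 \<le> x \<Longrightarrow> x < y \<Longrightarrow> y \<le> 1 \<Longrightarrow> norm (\<rho> y - \<rho> x) \<le> M * (y - x)"
  shows "abs_cont01 \<rho>"
  unfolding abs_cont01_def
proof (intro allI impI)
  fix \<epsilon> :: real assume e: "\<epsilon> > 0"
  have "(\<Sum>(a,b)\<in>D. norm (\<rho> b - \<rho> a)) < \<epsilon>"
    if D: "\<forall>(a,b)\<in>D. 0 \<le> a \<and> a < b \<and> b \<le> 1" and s: "(\<Sum>(a,b)\<in>D. b - a) < \<epsilon> / (\<bar>M\<bar> + 1)"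
    for D :: "(real \<times> real) set"
  proof -
    have "(\<Sum>(a,b)\<in>D. norm (\<rho> b - \<rho> a)) \<le> (\<Sum>(a,b)\<in>D. (\<bar>M\<bar> + 1) * (b - a))"
    proof (rule sum_mono, clarsimp)
      fix a b assume "(a, b) \<in> D"
      then have ab: "0 \<le> a" "a < b" "b \<le> 1" using D by auto
      have "M * (b - a) \<le> (\<bar>M\<bar> + 1) * (b - a)" using ab by (intro mult_right_mono) auto
      then show "norm (\<rho> b - \<rho> a) \<le> (\<bar>M\<bar> + 1) * (b - a)" using L[OF ab] by simp
    qed
    also have "\<dots> = (\<bar>M\<bar> + 1) * (\<Sum>(a,b)\<in>D. b - a)"
      by (simp add: sum_distrib_left case_prod_unfold)
    also have "\<dots> < \<epsilon>" using s by (simp add: field_simps)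
    finally show ?thesis .
  qed
  then show "\<exists>\<delta>>0. \<forall>D::(real \<times> real) set.
        finite D \<longrightarrow>
        (\<forall>(a,b)\<in>D. 0 \<le> a \<and> a < b \<and> b \<le> 1) \<longrightarrow>
        (\<forall>(a,b)\<in>D. \<forall>(c,d)\<in>D. (a,b) \<noteq> (c,d) \<longrightarrow> {a<..<b} \<inter> {c<..<d} = {}) \<longrightarrow>
        (\<Sum>(a,b)\<in>D. b - a) < \<delta> \<longrightarrow>
        (\<Sum>(a,b)\<in>D. norm (\<rho> b - \<rho> a)) < \<epsilon>"
    using e by (intro exI[of _ "\<epsilon> / (\<bar>M\<bar> + 1)"]) auto
qed

text \<open>Boundedness makes the primitive Lipschitz, hence absolutely continuous. The half-open
  support lets two compressed copies sit side by side without meeting.\<close>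

definition velocity_profile :: "(real \<Rightarrow> 'a::euclidean_space) \<Rightarrow> bool" where
  "velocity_profile d \<longleftrightarrow> d \<in> borel_measurable borel \<and> bounded (range d) \<and> (\<forall>t. t \<notin> {0..<1} \<longrightarrow> d t = 0)"

text \<open>\<open>r\<close> only bounds the length: this puts the whole epigraph of
  \<open>F\<close> into the set and keeps infinite lengths out.\<close>

definition attainable :: "('a::euclidean_space \<Rightarrow> real) \<Rightarrow> ('a \<times> real) set" where
  "attainable F = {(v, r). 0 \<le> r \<and> (\<exists>d. velocity_profile d \<and> (LINT t|lborel. d t) = v \<and>
     (\<integral>\<^sup>+ t. ennreal (F (d t)) \<partial>lborel) \<le> ennreal r)}"

lemma velocity_profile_integrable:
  assumes "velocity_profile d" shows "integrable lborel d"
proof -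
  obtain B where "\<And>t. norm (d t) \<le> B"
    using assms by (auto simp: velocity_profile_def bounded_iff)
  then show ?thesis
    using assms by (intro integrableI_bounded_set[where A="{0..<1}" and B=B]) (auto simp: velocity_profile_def)
qed

lemma attainable_scaleR:
  assumes F: "integrand F" and c: "c \<ge> 0" and p: "p \<in> attainable F"
  shows "c *\<^sub>R p \<in> attainable F"
proof -
  obtain v r d where vr: "p = (v, r)" "0 \<le> r" "velocity_profile d" "(LINT t|lborel. d t) = v"
    "(\<integral>\<^sup>+ t. ennreal (F (d t)) \<partial>lborel) \<le> ennreal r"
    using p by (auto simp: attainable_def)
  note [measurable] = integrand_borel[OF F]
  have dm [measurable]: "d \<in> borel_measurable borel" using vr(3) by (simp add: velocity_profile_def)
  have "bounded ((\<lambda>x. c *\<^sub>R x) ` range d)"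
    using vr(3) by (intro bounded_scaling) (simp add: velocity_profile_def)
  then have "velocity_profile (\<lambda>t. c *\<^sub>R d t)"
    using vr(3) by (auto simp: velocity_profile_def image_image)
  moreover have "(LINT t|lborel. c *\<^sub>R d t) = c *\<^sub>R v" using vr(4) by simp
  moreover have "(\<integral>\<^sup>+ t. ennreal (F (c *\<^sub>R d t)) \<partial>lborel) \<le> ennreal (c * r)"
  proof -
    have "(\<integral>\<^sup>+ t. ennreal (F (c *\<^sub>R d t)) \<partial>lborel) = ennreal c * (\<integral>\<^sup>+ t. ennreal (F (d t)) \<partial>lborel)"
      using c by (subst nn_integral_cmult[symmetric])
        (auto simp: integrand_scaleR[OF F] ennreal_mult' )
    also have "\<dots> \<le> ennreal c * ennreal r" using vr(5) by (intro mult_left_mono) auto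
    finally show ?thesis using c by (simp add: ennreal_mult')
  qed
  ultimately show ?thesis using vr c by (auto simp: attainable_def)
qed

text \<open>Two velocity profiles are run one after the other, each at double speed; their supports
  are then disjoint.\<close>

lemma attainable_add:
  assumes F: "integrand F" and p: "p \<in> attainable F" and q: "q \<in> attainable F"
  shows "p + q \<in> attainable F"
proof -
  obtain v r d where vr: "p = (v, r)" "0 \<le> r" "velocity_profile d" "(LINT t|lborel. d t) = v"
    "(\<integral>\<^sup>+ t. ennreal (F (d t)) \<partial>lborel) \<le> ennreal r"
    using p by (auto simp: attainable_def)
  obtain w s e where ws: "q = (w, s)" "0 \<le> s" "velocity_profile e" "(LINT t|lborel. e t) = w"
    "(\<integral>\<^sup>+ t. ennreal (F (e t)) \<partial>lborel) \<le> ennreal s"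
    using q by (auto simp: attainable_def)
  note [measurable] = integrand_borel[OF F]
  have [measurable]: "d \<in> borel_measurable borel" "e \<in> borel_measurable borel"
    using vr(3) ws(3) by (auto simp: velocity_profile_def)
  \<comment> \<open>The factor 2 makes up for the halved time; the arguments are written in the form
    of affine substitutions.\<close>
  define D where "D t = 2 *\<^sub>R d (0 + 2 * t) + 2 *\<^sub>R e (-1 + 2 * t)" for t
  have "velocity_profile D"
    unfolding velocity_profile_def
  proof (intro conjI allI impI)
    show "D \<in> borel_measurable borel" unfolding D_def by measurable
    obtain B C where "\<And>t. norm (d t) \<le> B" "\<And>t. norm (e t) \<le> C"
      using vr(3) ws(3) by (auto simp: velocity_profile_def bounded_iff)
    then have "norm (D t) \<le> 2 * B + 2 * C" for t
      unfolding D_def by (intro norm_triangle_le add_mono) auto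
    then show "bounded (range D)" by (auto simp: bounded_iff)
    fix t :: real assume "t \<notin> {0..<1}"
    then have "2 * t \<notin> {0..<1}" "-1 + 2 * t \<notin> {0..<1}" by auto
    then show "D t = 0" using vr(3) ws(3) by (auto simp: velocity_profile_def D_def)
  qed
  moreover have "(LINT t|lborel. D t) = v + w"
  proof -
    have "integrable lborel (\<lambda>t. d (0 + 2 * t))" "integrable lborel (\<lambda>t. e (-1 + 2 * t))"
      using lborel_integrable_real_affine[OF velocity_profile_integrable[OF vr(3)], of 2 0]
        lborel_integrable_real_affine[OF velocity_profile_integrable[OF ws(3)], of 2 "-1"] by auto
    then have "(LINT t|lborel. D t) = 2 *\<^sub>R (LINT t|lborel. d (0 + 2 * t)) + 2 *\<^sub>R (LINT t|lborel. e (-1 + 2 * t))"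
      unfolding D_def by (subst Bochner_Integration.integral_add) auto
    then show ?thesis
      using lborel_integral_real_affine[of 2 d 0] lborel_integral_real_affine[of 2 e "-1"] vr(4) ws(4) by simp
  qed
  moreover have "(\<integral>\<^sup>+ t. ennreal (F (D t)) \<partial>lborel) \<le> ennreal (r + s)"
  proof -
    \<comment> \<open>\<open>F\<close> is not additive; the identity holds because one of the two
      summands vanishes at each \<open>t\<close>.\<close>
    have "F (D t) = 2 * F (d (0 + 2 * t)) + 2 * F (e (-1 + 2 * t))" for t
    proof -
      have "d (0 + 2 * t) = 0 \<or> e (-1 + 2 * t) = 0"
      proof (cases "t < 1 / 2")
        case True
        then have "-1 + 2 * t \<notin> {0..<1}" by auto
        then show ?thesis using ws(3) by (auto simp: velocity_profile_def)
      next
        case False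
        then have "0 + 2 * t \<notin> {0..<1}" by auto
        then show ?thesis using vr(3) by (auto simp: velocity_profile_def)
      qed
      then show ?thesis
        using integrand_zero[OF F] by (auto simp: D_def integrand_scaleR[OF F])
    qed
    then have "(\<integral>\<^sup>+ t. ennreal (F (D t)) \<partial>lborel)
        = (\<integral>\<^sup>+ t. 2 * ennreal (F (d (0 + 2 * t))) + 2 * ennreal (F (e (-1 + 2 * t))) \<partial>lborel)"
      by (intro nn_integral_cong) (simp add: integrand_nonneg[OF F] ennreal_mult)
    also have "\<dots> = 2 * (\<integral>\<^sup>+ t. ennreal (F (d (0 + 2 * t))) \<partial>lborel)
        + 2 * (\<integral>\<^sup>+ t. ennreal (F (e (-1 + 2 * t))) \<partial>lborel)"
      by (subst nn_integral_add) (auto simp: nn_integral_cmult)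
    also have "\<dots> = (\<integral>\<^sup>+ t. ennreal (F (d t)) \<partial>lborel) + (\<integral>\<^sup>+ t. ennreal (F (e t)) \<partial>lborel)"
      using nn_integral_real_affine[of "\<lambda>t. ennreal (F (d t))" 2 0]
        nn_integral_real_affine[of "\<lambda>t. ennreal (F (e t))" 2 "-1"] by simp
    also have "\<dots> \<le> ennreal (r + s)" using vr ws by (simp add: add_mono)
    finally show ?thesis .
  qed
  ultimately show ?thesis using vr ws by (auto simp: attainable_def)
qed

lemma attainable_epigraph:
  assumes F: "integrand F" and "F w \<le> r" shows "(w, r) \<in> attainable F"
proof -
  let ?d = "\<lambda>t::real. indicator {0..<1} t *\<^sub>R w"
  have "velocity_profile ?d"
    by (auto simp: velocity_profile_def bounded_iff indicator_def intro!: exI[of _ "norm w"])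
  moreover have "(LINT t|lborel. ?d t) = w" by simp
  moreover have "(\<integral>\<^sup>+ t. ennreal (F (?d t)) \<partial>lborel) = (\<integral>\<^sup>+ t. ennreal (F w) * indicator {0..<1} (t::real) \<partial>lborel)"
    by (intro nn_integral_cong) (auto simp: indicator_def integrand_zero[OF F])
  then have "(\<integral>\<^sup>+ t. ennreal (F (?d t)) \<partial>lborel) \<le> ennreal r"
    using assms(2) by (simp add: nn_integral_cmult_indicator ennreal_leI)
  ultimately show ?thesis
    using assms(2) integrand_nonneg[OF F, of w] by (auto simp: attainable_def)
qed

lemma support_fun_attainable:
  assumes F: "integrand F" and "support_fun F v < c" shows "(v, c) \<in> attainable F"
proof (rule convex_cone_above_support_fun[OF F])
  show "convex (attainable F)"
    by (rule convexI) (auto intro!: attainable_add attainable_scaleR F)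
qed (use assms attainable_scaleR attainable_epigraph in auto)

text \<open>At 0 and 1 the two-sided derivative depends on values outside [0,1]; these two points
  are null.\<close>

lemma F_length_eqI:
  assumes "AE t in lebesgue. t \<in> {0<..<1} \<longrightarrow> (\<gamma> has_vector_derivative g t) (at t)"
  shows "F_length F \<gamma> = (\<integral>\<^sup>+ t\<in>{0..1}. ennreal (F (g t)) \<partial>lborel)"
proof -
  have "AE t in lebesgue. t \<notin> {0, 1::real}"
    by (intro AE_imp_negligible_notin negligible_finite) auto
  then have "F_length F \<gamma> = (\<integral>\<^sup>+ t\<in>{0..1}. ennreal (F (g t)) \<partial>lebesgue)"
    unfolding F_length_def using assms
    by (intro nn_integral_cong_AE, eventually_elim)
       (auto simp: vector_derivative_at indicator_def)
  then show ?thesis by (simp add: nn_integral_completion)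
qed

lemma exists_curve_near_support_fun:
  assumes F: "integrand F" and c: "support_fun F v < c"
  obtains \<rho> where "abs_cont01 \<rho>" "\<rho> 0 = p" "\<rho> 1 = p + v" "F_length F \<rho> \<le> ennreal c"
proof -
  obtain d where d: "velocity_profile d" "(LINT t|lborel. d t) = v"
    "(\<integral>\<^sup>+ t. ennreal (F (d t)) \<partial>lborel) \<le> ennreal c"
    using support_fun_attainable[OF F c] by (auto simp: attainable_def)
  note [measurable] = integrand_borel[OF F]
  have int: "integrable lborel d" by (rule velocity_profile_integrable[OF d(1)])
  have on: "d integrable_on {a..b}" for a b
    using integrable_on_lborel[OF int] by (rule integrable_on_subcbox[where 'n=real, unfolded box_real]) auto
  have v: "integral {0..1} d = v"
  proof -
    have "integral {0..1} d = integral UNIV (\<lambda>t. if t \<in> {0..1} then d t else 0)"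
      by (rule Henstock_Kurzweil_Integration.integral_restrict_UNIV[symmetric])
    also have "(\<lambda>t. if t \<in> {0..1} then d t else 0) = d"
      using d(1) by (auto simp: velocity_profile_def fun_eq_iff)
    also have "integral UNIV d = v"
      using has_integral_integral_lborel[OF int] d(2) by (metis integral_unique)
    finally show ?thesis .
  qed
  obtain B where B: "\<And>t. norm (d t) \<le> B" using d(1) by (auto simp: velocity_profile_def bounded_iff)
  define \<rho> where "\<rho> t = p + integral {0..t} d" for t
  show ?thesis
  proof (rule that)
    show "abs_cont01 \<rho>"
    proof (rule abs_cont01_Lipschitz)
      fix x y :: real assume xy: "0 \<le> x" "x < y" "y \<le> 1"
      have "\<rho> y - \<rho> x = integral {x..y} d"
        using Henstock_Kurzweil_Integration.integral_combine[of 0 x y d] on xy by (simp add: \<rho>_def algebra_simps)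
      also have "norm \<dots> \<le> B * (y - x)"
        using integral_norm_bound_integral[of d "{x..y}" "\<lambda>_. B"] xy B on
        by (simp add: integrable_const_ivl mult.commute)
      finally show "norm (\<rho> y - \<rho> x) \<le> B * (y - x)" .
    qed
    show "\<rho> 0 = p" "\<rho> 1 = p + v" by (simp_all add: \<rho>_def v)
    have "AE t in lebesgue. t \<in> {0<..<1} \<longrightarrow> (\<rho> has_vector_derivative d t) (at t)"
      using AE_has_vector_derivative_integral[OF on, of 0]
      by (auto elim!: eventually_mono simp: \<rho>_def[abs_def] intro!: derivative_eq_intros)
    then have "F_length F \<rho> = (\<integral>\<^sup>+ t\<in>{0..1}. ennreal (F (d t)) \<partial>lborel)" by (rule F_length_eqI)
    also have "\<dots> \<le> (\<integral>\<^sup>+ t. ennreal (F (d t)) \<partial>lborel)"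
      by (intro nn_integral_mono) (auto simp: indicator_def)
    finally show "F_length F \<rho> \<le> ennreal c" using d(3) by simp
  qed
qed

section \<open>Geodesics\<close>

text \<open>\<open>F\<close> of the velocity minus its inner product with \<open>x\<close> is
  nonnegative, and the inner product integrates to the constant
  \<open>(\<rho> 1 - \<rho> 0) \<bullet> x\<close>; equality of the integrals means that the
  difference vanishes almost everywhere.\<close>

lemma abs_cont01_F_length:
  assumes F: "integrand F" and x: "x \<in> crystal F" and ac: "abs_cont01 \<rho>"
  shows F_length_lower_bound: "ennreal ((\<rho> 1 - \<rho> 0) \<bullet> x) \<le> F_length F \<rho>"
    and F_length_eq_iff: "0 \<le> (\<rho> 1 - \<rho> 0) \<bullet> x \<Longrightarrow>
      F_length F \<rho> = ennreal ((\<rho> 1 - \<rho> 0) \<bullet> x) \<longleftrightarrow>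
      (AE t in lebesgue. t \<in> {0<..<1} \<longrightarrow> F (vector_derivative \<rho> (at t)) = x \<bullet> vector_derivative \<rho> (at t))"
proof -
  note [measurable] = integrand_borel[OF F]
  let ?c = "(\<rho> 1 - \<rho> 0) \<bullet> x"
  obtain g where g: "integrable lborel g" "(g has_integral (\<rho> 1 - \<rho> 0)) {0..1}"
    "AE t in lebesgue. t \<in> {0<..<1} \<longrightarrow> (\<rho> has_vector_derivative g t) (at t)"
    by (rule abs_cont01_FTC[OF ac])
  have [measurable]: "g \<in> borel_measurable borel" using borel_measurable_integrable[OF g(1)] by simp
  \<comment> \<open>Extension by zero adds no length since \<open>F 0 = 0\<close>, and allows
    integrals over the whole line.\<close>
  define h where "h t = indicator {0..1} t *\<^sub>R g t" for t :: real
  have h: "integrable lborel h"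
    unfolding h_def using integrable_mult_indicator[of "{0..1}" lborel g] g(1) by simp
  have [measurable]: "h \<in> borel_measurable borel" using borel_measurable_integrable[OF h] by simp
  have "(h has_integral (\<rho> 1 - \<rho> 0)) UNIV"
  proof -
    have "h = (\<lambda>t. if t \<in> {0..1} then g t else 0)" by (auto simp: h_def fun_eq_iff indicator_def)
    then show ?thesis using g(2) by (simp only: has_integral_restrict_UNIV)
  qed
  then have hI: "(LINT t|lborel. h t) = \<rho> 1 - \<rho> 0"
    using has_integral_integral_lborel[OF h] by (rule has_integral_unique[rotated])
  have xh: "integrable lborel (\<lambda>t. h t \<bullet> x)" "(LINT t|lborel. h t \<bullet> x) = ?c"
    using h hI by auto
  have len: "F_length F \<rho> = (\<integral>\<^sup>+ t. ennreal (F (h t)) \<partial>lborel)"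
    unfolding F_length_eqI[OF g(3)]
    by (intro nn_integral_cong) (auto simp: h_def indicator_def integrand_zero[OF F])
  have le: "h t \<bullet> x \<le> F (h t)" for t using x F mem_crystal_iff by (metis inner_commute)
  show lower: "ennreal ?c \<le> F_length F \<rho>"
  \<comment> \<open>Finiteness is what makes \<open>F (h t)\<close> integrable, so that real
    integrals can be compared.\<close>
  proof (cases "F_length F \<rho> = \<infinity>")
    case False
    then have intF: "integrable lborel (\<lambda>t. F (h t))"
      unfolding len by (intro integrableI_bounded) (auto simp: integrand_nonneg[OF F] less_top)
    have "?c \<le> (LINT t|lborel. F (h t))"
      unfolding xh(2)[symmetric] by (intro integral_mono xh intF le)
    then show ?thesis
      unfolding len nn_integral_eq_integral[OF intF AE_I2[OF integrand_nonneg[OF F]]] by (rule ennreal_leI)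
  qed simp
  \<comment> \<open>Nonnegativity of \<open>?c\<close> matters: \<open>ennreal\<close> sends
    negative reals to 0.\<close>
  show "F_length F \<rho> = ennreal ?c \<longleftrightarrow>
      (AE t in lebesgue. t \<in> {0<..<1} \<longrightarrow> F (vector_derivative \<rho> (at t)) = x \<bullet> vector_derivative \<rho> (at t))"
    if c: "0 \<le> ?c"
  proof -
    have "F_length F \<rho> = ennreal ?c \<longleftrightarrow> (AE t in lborel. F (h t) = h t \<bullet> x)"
    proof
      assume eq: "F_length F \<rho> = ennreal ?c"
      then have intF: "integrable lborel (\<lambda>t. F (h t))"
        unfolding len by (intro integrableI_bounded) (auto simp: integrand_nonneg[OF F])
      have "(LINT t|lborel. F (h t)) = ?c"
        using eq c unfolding len nn_integral_eq_integral[OF intF AE_I2[OF integrand_nonneg[OF F]]]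
        by (simp add: integral_nonneg_AE integrand_nonneg[OF F])
      then have "(LINT t|lborel. F (h t) - h t \<bullet> x) = 0"
        using xh intF by simp
      then have "AE t in lborel. F (h t) - h t \<bullet> x = 0"
        using integral_nonneg_eq_0_iff_AE[of lborel "\<lambda>t. F (h t) - h t \<bullet> x"] intF xh(1) le by simp
      then show "AE t in lborel. F (h t) = h t \<bullet> x" by simp
    next
      assume ae: "AE t in lborel. F (h t) = h t \<bullet> x"
      have "F_length F \<rho> = (\<integral>\<^sup>+ t. ennreal (h t \<bullet> x) \<partial>lborel)"
        unfolding len using ae by (intro nn_integral_cong_AE) auto
      also have "\<dots> = ennreal ?c"
      proof -
        have "AE t in lborel. 0 \<le> h t \<bullet> x"
          using ae by eventually_elim (metis integrand_nonneg[OF F])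
        then show ?thesis using nn_integral_eq_integral[OF xh(1)] xh(2) by simp
      qed
      finally show "F_length F \<rho> = ennreal ?c" .
    qed
    also have "\<dots> \<longleftrightarrow> (AE t in lebesgue. F (h t) = h t \<bullet> x)" by (simp add: AE_completion_iff)
    also have "\<dots> \<longleftrightarrow> (AE t in lebesgue. t \<in> {0<..<1} \<longrightarrow>
        F (vector_derivative \<rho> (at t)) = x \<bullet> vector_derivative \<rho> (at t))"
    \<comment> \<open>Off [0,1] both sides hold trivially, the left one as \<open>h t = 0\<close>;
      the end points are discarded as a null set.\<close>
    proof (rule eventually_subst)
      have "AE t in lebesgue. t \<notin> {0, 1::real}"
        by (intro AE_imp_negligible_notin negligible_finite) auto
      then show "AE t in lebesgue. (F (h t) = h t \<bullet> x) = (t \<in> {0<..<1} \<longrightarrow>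
          F (vector_derivative \<rho> (at t)) = x \<bullet> vector_derivative \<rho> (at t))"
        using g(3)
        by eventually_elim
          (auto simp: h_def indicator_def integrand_zero[OF F] vector_derivative_at inner_commute)
    qed
    finally show ?thesis .
  qed
qed

theorem theorem1p2:
  fixes F :: "'a::euclidean_space \<Rightarrow> real"
    and \<gamma> :: "real \<Rightarrow> 'a"
    and xbar :: 'a
  assumes "DIM('a) \<ge> 2"
    and "integrand F"
    and "abs_cont01 \<gamma>"
    and "regular_curve \<gamma>"
    and "xbar \<in> crystal F"
    and "F_norm F (\<gamma> 1 - \<gamma> 0) = (\<gamma> 1 - \<gamma> 0) \<bullet> xbar"
  shows "(F_geodesic F \<gamma> \<longleftrightarrow> F_length F \<gamma> = ennreal (F_norm F (\<gamma> 1 - \<gamma> 0)))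
       \<and> (F_length F \<gamma> = ennreal (F_norm F (\<gamma> 1 - \<gamma> 0)) \<longleftrightarrow>
           (AE t in lebesgue. t \<in> {0<..<1} \<longrightarrow>
              vector_derivative \<gamma> (at t) \<in> Cont F \<and>
              {z. (z - xbar) \<bullet> vector_derivative \<gamma> (at t) = 0} =
                supp_hyperplane (crystal F)
                  (vector_derivative \<gamma> (at t) /\<^sub>R norm (vector_derivative \<gamma> (at t)))))"
proof -
  note F = assms(2) and ac = assms(3) and x = assms(5) and n = assms(6)
  let ?v = "\<gamma> 1 - \<gamma> 0" and ?d = "\<lambda>t. vector_derivative \<gamma> (at t)"
  have nonneg: "0 \<le> ?v \<bullet> xbar"
    using support_fun_nonneg[OF F, of ?v] by (simp add: n[symmetric] F_norm_eq_support_fun[OF F])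
  have "F_geodesic F \<gamma> \<longleftrightarrow> F_length F \<gamma> = ennreal (F_norm F ?v)"
  proof
    assume geo: "F_geodesic F \<gamma>"
    \<comment> \<open>Comparison with a competitor of length at most \<open>F_norm F ?v + e\<close>;
      letting \<open>e\<close> tend to 0 replaces an exact minimizer.\<close>
    have "F_length F \<gamma> \<le> ennreal (F_norm F ?v) + ennreal e" if "e > 0" for e
    proof -
      have "support_fun F ?v < F_norm F ?v + e" using that by (simp add: F_norm_eq_support_fun[OF F])
      then obtain \<rho> where \<rho>: "abs_cont01 \<rho>" "\<rho> 0 = \<gamma> 0" "\<rho> 1 = \<gamma> 0 + ?v"
        "F_length F \<rho> \<le> ennreal (F_norm F ?v + e)"
        by (rule exists_curve_near_support_fun[OF F, where p="\<gamma> 0"])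
      have "F_length F \<gamma> \<le> F_length F \<rho>" using geo \<rho> by (simp add: F_geodesic_def)
      also note \<rho>(4)
      finally show ?thesis using that nonneg n by simp
    qed
    then have "F_length F \<gamma> \<le> ennreal (F_norm F ?v)" by (rule ennreal_le_epsilon)
    then show "F_length F \<gamma> = ennreal (F_norm F ?v)"
      using F_length_lower_bound[OF F x ac] unfolding n by (rule antisym)
  next
    assume eq: "F_length F \<gamma> = ennreal (F_norm F ?v)"
    show "F_geodesic F \<gamma>"
      unfolding F_geodesic_def
    proof (intro conjI ac allI impI)
      fix \<rho> assume \<rho>: "abs_cont01 \<rho> \<and> \<rho> 0 = \<gamma> 0 \<and> \<rho> 1 = \<gamma> 1"
      then show "F_length F \<gamma> \<le> F_length F \<rho>"
        using F_length_lower_bound[OF F x, of \<rho>] eq n by simp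
    qed
  qed
  moreover have "F_length F \<gamma> = ennreal (F_norm F ?v) \<longleftrightarrow>
      (AE t in lebesgue. t \<in> {0<..<1} \<longrightarrow> ?d t \<in> Cont F \<and>
        {z. (z - xbar) \<bullet> ?d t = 0} = supp_hyperplane (crystal F) (?d t /\<^sub>R norm (?d t)))"
    unfolding n F_length_eq_iff[OF F x ac nonneg]
  proof (rule eventually_subst)
    show "AE t in lebesgue. (t \<in> {0<..<1} \<longrightarrow> F (?d t) = xbar \<bullet> ?d t) =
      (t \<in> {0<..<1} \<longrightarrow> ?d t \<in> Cont F \<and>
        {z. (z - xbar) \<bullet> ?d t = 0} = supp_hyperplane (crystal F) (?d t /\<^sub>R norm (?d t)))"
      using assms(4)[unfolded regular_curve_def]
    proof (rule eventually_mono)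
      \<comment> \<open>Regularity makes the velocity nonzero, so it has a direction and the
        pointwise criterion applies.\<close>
      fix t :: real assume "t \<in> {0..1} \<longrightarrow> 0 < norm (?d t)"
      then have "t \<in> {0<..<1} \<Longrightarrow> ?d t \<noteq> 0" by auto
      then show "(t \<in> {0<..<1} \<longrightarrow> F (?d t) = xbar \<bullet> ?d t) =
        (t \<in> {0<..<1} \<longrightarrow> ?d t \<in> Cont F \<and>
          {z. (z - xbar) \<bullet> ?d t = 0} = supp_hyperplane (crystal F) (?d t /\<^sub>R norm (?d t)))"
        using Cont_hyperplane_iff[OF F x] by blast
    qed
  qed
  ultimately show ?thesis by blast
qed

end
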